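(* Let $\beta>2$ and $q$ an integer with $\beta\sin^2(\frac{\pi}{q})<1$. For any $\nu'\in\mathcal P(\{1,\dots,q\})$ with $\Psi'(\nu')<\Psi'(\frac1q\sum_{k=1}^q\delta_k)$ and any open set $U\subset\mathcal P(\{1,\dots,q\})$ containing $\mathcal G'$, there is a finite time $t\ge0$ with $\phi(t,\nu')\in U$.
   Context: Scalar-product model: $S^1\cong[0,2\pi)$, $\alpha$ Lebesgue measure, $e_s=(\cos s,\sin s)$, $\Phi(\nu)=-\frac\beta2\|\int e_s\nu(ds)\|^2$, $S(\nu|\alpha)$ relative entropy, $\Psi(\nu)=\Phi(\nu)+S(\nu|\alpha)-\inf_{\tilde\nu}(\Phi(\tilde\nu)+S(\tilde\nu|\alpha))$. $S_k=[\tfrac{2\pi}{q}(k-1),\tfrac{2\pi}{q}k)$, $T(\nu)(k)=\nu(S_k)$, indices modulo $q$. For $\nu'\in\mathcal P(\{1,\dots,q\})$, $\nu^{\nu'}$ is the unique minimizer of $\Phi+S(\cdot|\alpha)$ over $\{\nu:T(\nu)=\nu'\}$, $\Psi'(\nu')=\Psi(\nu^{\nu'})$, $\mathcal G'=\operatorname{argmin}\Psi'$ (the periodic orbit). $M_\beta(\nu')=\int e_\omega\nu^{\nu'}(d\omega)$, $c(k,\nu')=e^{\beta\langle e_{2\pi k/q},M_\beta(\nu')\rangle}/\int_{S_k}e^{\beta\langle e_\omega,M_\beta(\nu')\rangle}\alpha(d\omega)$, $F(\nu')(k)=c(k-1,\nu')\nu'(k-1)-c(k,\nu')\nu'(k)$,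 and $\phi(t,\nu')$ solves $\frac{d}{dt}\phi=F(\phi)$, $\phi(0,\nu')=\nu'$. *)

theory Defs
  imports "HOL-Probability.Probability"
begin

text \<open>S^1 is identified with [0,2pi); alpha is Lebesgue measure on [0,2pi).\<close>
definition alpha :: "real measure" where
  "alpha = restrict_space lborel {0..<2*pi}"

definition Probs :: "real measure set" where
  "Probs = {\<nu>. prob_space \<nu> \<and> sets \<nu> = sets alpha}"

text \<open>Interaction energy Phi(nu) = -beta/2 * |int e_s nu(ds)|^2 with e_s = (cos s, sin s).\<close>
definition Phi :: "real \<Rightarrow> real measure \<Rightarrow> real" where
  "Phi \<beta> \<nu> = - (\<beta> / 2) * ((\<integral>s. cos s \<partial>\<nu>)\<^sup>2 + (\<integral>s. sin s \<partial>\<nu>)\<^sup>2)"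

text \<open>Relative entropy S(nu|alpha) = int f log f d alpha with f = d nu / d alpha
  (with 0 log 0 = 0), and +infinity if nu is not absolutely continuous w.r.t. alpha.
  The negative part of f log f is bounded, so the integral is well defined in the extended reals.\<close>
definition xlogx :: "real \<Rightarrow> real" where
  "xlogx x = (if x = 0 then 0 else x * ln x)"

definition rel_entropy :: "real measure \<Rightarrow> ereal" where
  "rel_entropy \<nu> =
     (if absolutely_continuous alpha \<nu> then
        enn2ereal (\<integral>\<^sup>+x. ennreal (max 0 (xlogx (enn2real (RN_deriv alpha \<nu> x)))) \<partial>alpha)
        - enn2ereal (\<integral>\<^sup>+x. ennreal (max 0 (- xlogx (enn2real (RN_deriv alpha \<nu> x)))) \<partial>alpha)
      else \<infinity>)"

definition FE :: "real \<Rightarrow> real measure \<Rightarrow> ereal" where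
  "FE \<beta> \<nu> = ereal (Phi \<beta> \<nu>) + rel_entropy \<nu>"

definition Psi :: "real \<Rightarrow> real measure \<Rightarrow> ereal" where
  "Psi \<beta> \<nu> = FE \<beta> \<nu> - (INF \<mu>\<in>Probs. FE \<beta> \<mu>)"

definition probvec :: "nat \<Rightarrow> (nat \<Rightarrow> real) set" where
  "probvec q = {p. (\<forall>k. 0 \<le> p k) \<and> (\<forall>k. k \<notin> {1..q} \<longrightarrow> p k = 0) \<and> (\<Sum>k\<in>{1..q}. p k) = 1}"

definition arc :: "nat \<Rightarrow> nat \<Rightarrow> real set" where
  "arc q k = {2*pi/q * (real k - 1) ..< 2*pi/q * real k}"

definition Tmap :: "nat \<Rightarrow> real measure \<Rightarrow> (nat \<Rightarrow> real)" where
  "Tmap q \<nu> = (\<lambda>k. if k \<in> {1..q} then measure \<nu> (arc q k) else 0)"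

definition nu_of :: "real \<Rightarrow> nat \<Rightarrow> (nat \<Rightarrow> real) \<Rightarrow> real measure" where
  "nu_of \<beta> q p = (THE \<nu>. \<nu> \<in> Probs \<and> Tmap q \<nu> = p \<and>
       (\<forall>\<mu>\<in>Probs. Tmap q \<mu> = p \<longrightarrow> FE \<beta> \<nu> \<le> FE \<beta> \<mu>))"

definition Psi' :: "real \<Rightarrow> nat \<Rightarrow> (nat \<Rightarrow> real) \<Rightarrow> ereal" where
  "Psi' \<beta> q p = Psi \<beta> (nu_of \<beta> q p)"

definition G' :: "real \<Rightarrow> nat \<Rightarrow> (nat \<Rightarrow> real) set" where
  "G' \<beta> q = {p \<in> probvec q. \<forall>p'\<in>probvec q. Psi' \<beta> q p \<le> Psi' \<beta> q p'}"

definition uniform :: "nat \<Rightarrow> (nat \<Rightarrow> real)" where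
  "uniform q = (\<lambda>k. if k \<in> {1..q} then 1 / real q else 0)"

definition Mbeta :: "real \<Rightarrow> nat \<Rightarrow> (nat \<Rightarrow> real) \<Rightarrow> real \<times> real" where
  "Mbeta \<beta> q p = (\<integral>\<omega>. cos \<omega> \<partial>(nu_of \<beta> q p), \<integral>\<omega>. sin \<omega> \<partial>(nu_of \<beta> q p))"

definition ccoef :: "real \<Rightarrow> nat \<Rightarrow> nat \<Rightarrow> (nat \<Rightarrow> real) \<Rightarrow> real" where
  "ccoef \<beta> q k p =
     (let M = Mbeta \<beta> q p;
          g = (\<lambda>\<omega>. exp (\<beta> * (cos \<omega> * fst M + sin \<omega> * snd M)))
      in g (2*pi*real k/q) / (\<integral>\<omega>. indicator (arc q k) \<omega> * g \<omega> \<partial>alpha))"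

definition prevq :: "nat \<Rightarrow> nat \<Rightarrow> nat" where
  "prevq q k = (if k = 1 then q else k - 1)"

definition Fvec :: "real \<Rightarrow> nat \<Rightarrow> (nat \<Rightarrow> real) \<Rightarrow> (nat \<Rightarrow> real)" where
  "Fvec \<beta> q p = (\<lambda>k. if k \<in> {1..q} then
       ccoef \<beta> q (prevq q k) p * p (prevq q k) - ccoef \<beta> q k p * p k else 0)"

end

theory Submission
  imports Defs "HOL-Real_Asymp.Real_Asymp"
begin

text \<open>
  Completing the square in the interaction turns the minimisation of the free energy over a fibre
  of T into the minimisation over M of G p M = beta/2 |M|^2 - sum_k p_k ln Z_k(M), up to the entropy
  H p of p, where Z_k(M) is the integral of exp(beta <e,M>) over the k-th arc. The Hessian of
  ln Z_k is beta^2 times a covariance of points in a disc of radius sin(pi/q), so that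
  beta sin^2(pi/q) < 1 makes G p strongly convex. Its minimiser Mstar p is the fixed point of the
  mean-field map, and Psi' equals V p = H p + G p (Mstar p) up to a constant.

  Along the flow, V decreases at the rate sum_k J_k (ln a_k - ln a_(k+1)) with a_k = p_k / Z_k and
  J_k the flux from k to k+1. By ln x <= x - 1 and an integration by parts this is nonnegative, and
  it vanishes only if all a_k agree, that is, if p solves the mean-field equation on the whole
  circle. Such a p is either uniform (Mstar p = 0) or a global minimiser, because the mean of
  sin^2 under exp(x cos) decreases in x. Since the flow stays in a compact part of the interior of
  the simplex, a trajectory below the level of the uniform vector that avoided U would dissipate
  at a rate bounded away from zero forever.
\<close>

subsection \<open>Exponential tilts on an interval\<close>

text \<open>Two obstacles shape the argument. \<open>Mstar\<close> is only shown to be Lipschitz, so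
  \<open>V\<close> is differentiated along the flow by squeezing minimal values instead of by a
  chain rule through \<open>Mstar\<close>. And the entropy has infinite slope at the boundary of the
  simplex, where a trajectory may start: \<open>V\<close> is differentiated only at positive times,
  when every coordinate is already positive, and at time 0 continuity has to suffice. The quantities
  a_k come from the density of nu^p, which on the k-th arc is a_k times the Gibbs weight exp(beta
  <e,M>). The jump rates are such that J_k is the value of this density at the right end of the arc.
  One elementary fact, that x ln x lies above its tangents, then serves three times: for the
  minimiser over a fibre, for the sign of the dissipation, and for the comparison of
  \<open>V\<close> with the functional of the whole circle.\<close>

lemma has_real_derivative_integral_tilt:
  fixes a b :: real and u f h :: "real \<Rightarrow> real"
  assumes "continuous_on {a..b} u" "continuous_on {a..b} f" "continuous_on {a..b} h"
  shows "((\<lambda>s. integral {a..b} (\<lambda>x. h x * exp (u x + s * f x))) has_real_derivative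
      integral {a..b} (\<lambda>x. h x * f x * exp (u x + s * f x))) (at s)"
proof -
  have *: "continuous_on (UNIV \<times> {a..b}) (\<lambda>z. g (snd z))" if "continuous_on {a..b} g" for g :: "real \<Rightarrow> real"
    by (rule continuous_on_compose2[OF that]) (auto intro: continuous_intros)
  show ?thesis
    using leibniz_rule_field_derivative[where U=UNIV and a=a and b=b and ?x0.0=s
        and f="\<lambda>s x. h x * exp (u x + s * f x)" and fx="\<lambda>s x. h x * f x * exp (u x + s * f x)"]
    by (force intro!: derivative_eq_intros integrable_continuous_real continuous_intros assms *
        simp: split_beta)
qed

lemma integral_pos_continuous:
  fixes a b :: real and g :: "real \<Rightarrow> real"
  assumes "a < b" "continuous_on {a..b} g" "\<And>x. x \<in> {a..b} \<Longrightarrow> 0 < g x"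
  shows "0 < integral {a..b} g"
proof -
  have "integral {a..b} g \<ge> 0" "integral {a..b} g \<noteq> 0"
    using assms integral_eq_0_iff[OF assms(2,1)]
    by (fastforce intro!: integral_nonneg integrable_continuous_real intro: less_imp_le)+
  then show ?thesis by linarith
qed

text \<open>The second derivative of the log-partition function is the variance of the tilted law,
  hence at most the squared radius of the range of f.\<close>
lemma ln_integral_tilt_le:
  fixes a b c r :: real and u f :: "real \<Rightarrow> real"
  assumes ab: "a < b" and u: "continuous_on {a..b} u" and f: "continuous_on {a..b} f"
    and r: "\<And>x. x \<in> {a..b} \<Longrightarrow> \<bar>f x - c\<bar> \<le> r"
  shows "ln (integral {a..b} (\<lambda>x. exp (u x + f x))) \<le> ln (integral {a..b} (\<lambda>x. exp (u x)))
    + integral {a..b} (\<lambda>x. f x * exp (u x)) / integral {a..b} (\<lambda>x. exp (u x)) + r\<^sup>2 / 2"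
proof -
  define J where "J s = integral {a..b} (\<lambda>x. exp (u x + s * f x))" for s
  define N where "N s = integral {a..b} (\<lambda>x. f x * exp (u x + s * f x))" for s
  define Q where "Q s = integral {a..b} (\<lambda>x. f x * f x * exp (u x + s * f x))" for s
  have cont: "continuous_on {a..b} (\<lambda>x. exp (u x + s * f x))" for s
    by (intro continuous_intros u f)
  have Jpos: "J s > 0" for s
    unfolding J_def by (rule integral_pos_continuous[OF ab cont]) simp
  \<comment> \<open>The free factor \<open>h\<close> of the differentiation lemma makes it usable
    twice: \<open>h = 1\<close> yields the first moment and \<open>h = f\<close> the second.\<close>
  have dJ: "(J has_real_derivative N s) (at s)" for s
    using has_real_derivative_integral_tilt[OF u f, of "\<lambda>_. 1"] unfolding J_def[abs_def] N_def by simp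
  have dN: "(N has_real_derivative Q s) (at s)" for s
    using has_real_derivative_integral_tilt[OF u f f] unfolding N_def[abs_def] Q_def by simp
  have var: "Q s * J s - N s * N s \<le> r\<^sup>2 * (J s)\<^sup>2" for s
  proof -
    have ii: "(\<lambda>x. exp (u x + s * f x)) integrable_on {a..b}"
      "(\<lambda>x. f x * exp (u x + s * f x)) integrable_on {a..b}"
      "(\<lambda>x. f x * f x * exp (u x + s * f x)) integrable_on {a..b}"
      by (intro integrable_continuous_real continuous_intros u f)+
    have "0 \<le> integral {a..b} (\<lambda>x. (r\<^sup>2 - (f x - c)\<^sup>2) * exp (u x + s * f x))"
    proof (rule integral_nonneg)
      show "(\<lambda>x. (r\<^sup>2 - (f x - c)\<^sup>2) * exp (u x + s * f x)) integrable_on {a..b}"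
        by (intro integrable_continuous_real continuous_intros u f)
      show "0 \<le> (r\<^sup>2 - (f x - c)\<^sup>2) * exp (u x + s * f x)" if "x \<in> {a..b}" for x
        using r[OF that] by (simp add: abs_le_square_iff[symmetric])
    qed
    also have "\<dots> = integral {a..b} (\<lambda>x. (r\<^sup>2 - c\<^sup>2) * exp (u x + s * f x)
        + 2 * c * (f x * exp (u x + s * f x)) - f x * f x * exp (u x + s * f x))"
      by (rule integral_cong) (simp add: power2_eq_square algebra_simps)
    also have "\<dots> = (r\<^sup>2 - c\<^sup>2) * J s + 2 * c * N s - Q s"
      unfolding J_def N_def Q_def
      by (intro integral_unique has_integral_diff has_integral_add has_integral_mult_right
          integrable_integral ii)
    finally have "Q s * J s \<le> ((r\<^sup>2 - c\<^sup>2) * J s + 2 * c * N s) * J s"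
      using Jpos[of s] by (intro mult_right_mono) auto
    \<comment> \<open>The second moment about \<open>c\<close> exceeds the variance by the squared
      distance of \<open>c\<close> from the mean; this is that square times
      \<open>(J s)\<^sup>2\<close>.\<close>
    moreover have "0 \<le> (N s - c * J s)\<^sup>2" by simp
    ultimately show ?thesis by (simp add: power2_eq_square algebra_simps)
  qed
  have dm: "((\<lambda>s. N s / J s) has_real_derivative (Q s * J s - N s * N s) / (J s * J s)) (at s)" for s
    using Jpos[of s] by (auto intro!: derivative_eq_intros dN dJ)
  \<comment> \<open>First integration of the variance bound; the function \<open>h\<close> below
    performs the second.\<close>
  have mean: "N s / J s \<le> N 0 / J 0 + s * r\<^sup>2" if "s \<ge> 0" for s
  proof -
    have "N s / J s - s * r\<^sup>2 \<le> N 0 / J 0 - 0 * r\<^sup>2"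
    proof (rule DERIV_nonpos_imp_nonincreasing[OF that])
      fix x
      have "(Q x * J x - N x * N x) / (J x * J x) \<le> r\<^sup>2"
        using var[of x] Jpos[of x] by (simp add: divide_le_eq power2_eq_square)
      moreover have "((\<lambda>s. N s / J s - s * r\<^sup>2) has_real_derivative
          (Q x * J x - N x * N x) / (J x * J x) - 1 * r\<^sup>2) (at x)"
        by (intro DERIV_diff dm DERIV_cmult_right DERIV_ident)
      ultimately show "\<exists>y. ((\<lambda>s. N s / J s - s * r\<^sup>2) has_real_derivative y) (at x) \<and> y \<le> 0"
        by force
    qed
    then show ?thesis by simp
  qed
  define h where "h s = ln (J s) - (N 0 / J 0 * s + s\<^sup>2 * r\<^sup>2 / 2)" for s
  have "h 1 \<le> h 0"
  proof (rule DERIV_nonpos_imp_nonincreasing[of 0 1 h])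
    fix s :: real assume "0 \<le> s"
    have "(h has_real_derivative N s / J s - (N 0 / J 0 * 1 + (2 * s) * r\<^sup>2 / 2)) (at s)"
      unfolding h_def[abs_def] using Jpos[of s] Jpos[of 0]
      by (auto intro!: derivative_eq_intros dJ)
    then show "\<exists>y. (h has_real_derivative y) (at s) \<and> y \<le> 0"
      using mean[OF \<open>0 \<le> s\<close>] by force
  qed simp
  then show ?thesis by (simp add: h_def J_def N_def)
qed

subsection \<open>Arcs of the circle and the mean-field fixed point\<close>

definition circ :: "real \<Rightarrow> real \<times> real" where
  "circ \<omega> = (cos \<omega>, sin \<omega>)"

lemma norm_circ [simp]: "norm (circ \<omega>) = 1"
  by (simp add: circ_def norm_prod_def)

lemma continuous_on_circ [continuous_intros]: "continuous_on S circ"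
  unfolding circ_def[abs_def] by (intro continuous_intros)

lemma inner_circ: "circ \<omega> \<bullet> M = cos \<omega> * fst M + sin \<omega> * snd M"
  by (simp add: circ_def inner_prod_def)

lemma probvec_nonneg: "p \<in> probvec q \<Longrightarrow> 0 \<le> p k"
  and probvec_sum: "p \<in> probvec q \<Longrightarrow> (\<Sum>k\<in>{1..q}. p k) = 1"
  and probvec_outside: "p \<in> probvec q \<Longrightarrow> k \<notin> {1..q} \<Longrightarrow> p k = 0"
  by (auto simp: probvec_def)

lemma probvec_le_1: "p \<in> probvec q \<Longrightarrow> p k \<le> 1"
  using member_le_sum[of k "{1..q}" p] probvec_nonneg[of p q] probvec_sum[of p q] probvec_outside[of p q k]
  by (cases "k \<in> {1..q}") auto

text \<open>With \<open>q_ge_2\<close> the half-angle pi/q of an arc is at most pi/2 and its cosine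
  is nonnegative. The case q = 1, where the simplex is a single point, is settled in the final
  theorem.\<close>

locale rotor =
  fixes \<beta> :: real and q :: nat
  assumes beta_pos: "0 < \<beta>" and q_ge_2: "2 \<le> q" and small: "\<beta> * (sin (pi / real q))\<^sup>2 < 1"
begin

abbreviation lo :: "nat \<Rightarrow> real" where "lo k \<equiv> 2*pi/q * (real k - 1)"
abbreviation hi :: "nat \<Rightarrow> real" where "hi k \<equiv> 2*pi/q * real k"

definition gw :: "real \<times> real \<Rightarrow> real \<Rightarrow> real" where
  "gw M \<omega> = exp (\<beta> * (circ \<omega> \<bullet> M))"

definition Z :: "nat \<Rightarrow> real \<times> real \<Rightarrow> real" where
  "Z k M = integral {lo k..hi k} (gw M)"

text \<open>Times \<open>\<beta>\<close>, this barycentre is the gradient of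
  \<open>ln (Z k M)\<close> in \<open>M\<close>.\<close>

definition arcmean :: "nat \<Rightarrow> real \<times> real \<Rightarrow> real \<times> real" where
  "arcmean k M = (integral {lo k..hi k} (\<lambda>\<omega>. cos \<omega> * gw M \<omega>) / Z k M,
                  integral {lo k..hi k} (\<lambda>\<omega>. sin \<omega> * gw M \<omega>) / Z k M)"

text \<open>The gradient of \<open>G p\<close> at \<open>M\<close> is \<open>\<beta>\<close> times
  \<open>M - mf p M\<close>, so the fixed points of \<open>mf p\<close> are the critical points of
  \<open>G p\<close>.\<close>

definition mf :: "(nat \<Rightarrow> real) \<Rightarrow> real \<times> real \<Rightarrow> real \<times> real" where
  "mf p M = (\<Sum>k\<in>{1..q}. p k *\<^sub>R arcmean k M)"

definition G :: "(nat \<Rightarrow> real) \<Rightarrow> real \<times> real \<Rightarrow> real" where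
  "G p M = \<beta> / 2 * (norm M)\<^sup>2 - (\<Sum>k\<in>{1..q}. p k * ln (Z k M))"

abbreviation lam :: real where "lam \<equiv> \<beta> * (sin (pi / real q))\<^sup>2"

lemma q_pos: "0 < real q" using q_ge_2 by simp

lemma lo_less_hi: "lo k < hi k"
  using q_pos by (intro mult_strict_left_mono) auto

lemma gw_pos: "0 < gw M \<omega>" by (simp add: gw_def)

lemma continuous_on_gw [continuous_intros]: "continuous_on S (gw M)"
  unfolding gw_def[abs_def] by (intro continuous_intros)

lemma continuous_on_gw_param [continuous_intros]:
  fixes S :: "'a::t2_space set"
  assumes "continuous_on S f" "continuous_on S g"
  shows "continuous_on S (\<lambda>x. gw (f x) (g x))"
  unfolding gw_def inner_circ by (intro continuous_intros assms)

lemma Z_pos: "0 < Z k M"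
  unfolding Z_def by (rule integral_pos_continuous[OF lo_less_hi]) (auto intro: continuous_intros gw_pos)

lemma inner_arcmean: "arcmean k M \<bullet> v = integral {lo k..hi k} (\<lambda>\<omega>. (circ \<omega> \<bullet> v) * gw M \<omega>) / Z k M"
proof -
  have "integral {lo k..hi k} (\<lambda>\<omega>. (circ \<omega> \<bullet> v) * gw M \<omega>)
     = integral {lo k..hi k} (\<lambda>\<omega>. fst v * (cos \<omega> * gw M \<omega>) + snd v * (sin \<omega> * gw M \<omega>))"
    by (rule integral_cong) (simp add: inner_circ algebra_simps)
  also have "\<dots> = fst v * integral {lo k..hi k} (\<lambda>\<omega>. cos \<omega> * gw M \<omega>)
      + snd v * integral {lo k..hi k} (\<lambda>\<omega>. sin \<omega> * gw M \<omega>)"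
    by (intro integral_unique has_integral_add has_integral_mult_right integrable_integral
        integrable_continuous_real continuous_intros)
  finally show ?thesis
    by (simp add: arcmean_def inner_prod_def add_divide_distrib mult.commute)
qed

text \<open>The smallest disc containing an arc of half-angle pi/q is centred at cos(pi/q) times the
  midpoint of the arc and has radius sin(pi/q).\<close>
lemma arc_in_disc:
  assumes \<omega>: "\<omega> \<in> {lo k..hi k}"
  shows "\<bar>circ \<omega> \<bullet> v - cos (pi/q) * (circ (2*pi/q * (real k - 1/2)) \<bullet> v)\<bar> \<le> sin (pi/q) * norm v"
proof -
  define m where "m = 2*pi/q * (real k - 1/2)"
  define c where "c = cos (pi/q)"
  have pq: "0 < pi / q" "pi/q \<le> pi/2" "pi/q \<le> pi"
    using q_ge_2 by (auto simp: field_simps)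
  have c0: "0 \<le> c" unfolding c_def using pq by (intro cos_ge_zero) linarith+
  have s0: "0 \<le> sin (pi/q)" using pq by (intro sin_ge_zero) linarith+
  have "\<bar>\<omega> - m\<bar> \<le> pi/q"
    using \<omega> by (auto simp: m_def abs_le_iff algebra_simps diff_divide_distrib)
  then have "cos (pi/q) \<le> cos \<bar>\<omega> - m\<bar>"
    using pq by (intro cos_monotone_0_pi_le) linarith+
  then have "c \<le> cos (\<omega> - m)" by (simp add: c_def cos_abs_real)
  then have cc: "c * c \<le> c * cos (\<omega> - m)" using c0 by (rule mult_left_mono)
  have "(norm (circ \<omega> - c *\<^sub>R circ m))\<^sup>2
      = (cos \<omega> - c * cos m)\<^sup>2 + (sin \<omega> - c * sin m)\<^sup>2"
    by (simp add: circ_def norm_prod_def)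
  also have "\<dots> = ((sin \<omega>)\<^sup>2 + (cos \<omega>)\<^sup>2) + c * c * ((sin m)\<^sup>2 + (cos m)\<^sup>2) - 2 * c * cos (\<omega> - m)"
    by (simp add: cos_diff power2_eq_square algebra_simps
        del: sin_cos_squared_add sin_cos_squared_add2 sin_cos_squared_add3)
  also have "\<dots> \<le> 1 - c\<^sup>2"
    unfolding sin_cos_squared_add using cc by (simp add: power2_eq_square)
  also have "\<dots> = (sin (pi/q))\<^sup>2" by (simp add: c_def sin_squared_eq)
  finally have "norm (circ \<omega> - c *\<^sub>R circ m) \<le> sin (pi/q)"
    using s0 by (rule power2_le_imp_le)
  then have "norm (circ \<omega> - c *\<^sub>R circ m) * norm v \<le> sin (pi/q) * norm v"
    by (rule mult_right_mono) simp
  then show ?thesis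
    using Cauchy_Schwarz_ineq2[of "circ \<omega> - c *\<^sub>R circ m" v]
    by (simp add: inner_diff_left c_def m_def)
qed

text \<open>On the arc the exponent \<beta> <e,v> stays within \<beta> sin(pi/q) |v| of a constant,
  and the square of this radius is \<open>\<beta> * lam * (norm v)\<^sup>2\<close>.\<close>

lemma ln_Z_le:
  "ln (Z k (M + v)) \<le> ln (Z k M) + \<beta> * (arcmean k M \<bullet> v) + \<beta> * lam * (norm v)\<^sup>2 / 2"
proof -
  have "ln (integral {lo k..hi k} (\<lambda>x. exp (\<beta> * (circ x \<bullet> M) + \<beta> * (circ x \<bullet> v))))
    \<le> ln (integral {lo k..hi k} (\<lambda>x. exp (\<beta> * (circ x \<bullet> M))))
    + integral {lo k..hi k} (\<lambda>x. \<beta> * (circ x \<bullet> v) * exp (\<beta> * (circ x \<bullet> M)))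
      / integral {lo k..hi k} (\<lambda>x. exp (\<beta> * (circ x \<bullet> M))) + (\<beta> * (sin (pi/q) * norm v))\<^sup>2 / 2"
  proof (rule ln_integral_tilt_le[OF lo_less_hi])
    show "\<bar>\<beta> * (circ x \<bullet> v) - \<beta> * (cos (pi/q) * (circ (2*pi/q * (real k - 1/2)) \<bullet> v))\<bar>
        \<le> \<beta> * (sin (pi/q) * norm v)" if "x \<in> {lo k..hi k}" for x
    proof -
      have "\<bar>\<beta> * (circ x \<bullet> v) - \<beta> * (cos (pi/q) * (circ (2*pi/q * (real k - 1/2)) \<bullet> v))\<bar>
        = \<beta> * \<bar>circ x \<bullet> v - cos (pi/q) * (circ (2*pi/q * (real k - 1/2)) \<bullet> v)\<bar>"
        using beta_pos by (simp add: abs_mult flip: right_diff_distrib)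
      then show ?thesis
        using arc_in_disc[OF that, of v] beta_pos by simp
    qed
  qed (intro continuous_intros)+
  moreover have "(\<lambda>x. exp (\<beta> * (circ x \<bullet> M) + \<beta> * (circ x \<bullet> v))) = gw (M + v)"
    by (simp add: gw_def inner_add_right distrib_left fun_eq_iff)
  moreover have "(\<lambda>x. exp (\<beta> * (circ x \<bullet> M))) = gw M" by (simp add: gw_def fun_eq_iff)
  moreover have "integral {lo k..hi k} (\<lambda>x. \<beta> * (circ x \<bullet> v) * exp (\<beta> * (circ x \<bullet> M)))
      = \<beta> * integral {lo k..hi k} (\<lambda>x. (circ x \<bullet> v) * gw M x)"
    by (simp only: gw_def mult.assoc integral_mult_right)
  ultimately have "ln (Z k (M + v)) \<le> ln (Z k M)
      + \<beta> * integral {lo k..hi k} (\<lambda>x. (circ x \<bullet> v) * gw M x) / Z k M + (\<beta> * (sin (pi/q) * norm v))\<^sup>2 / 2"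
    by (simp only: Z_def)
  then show ?thesis
    by (simp add: inner_arcmean power_mult_distrib power2_eq_square mult_ac)
qed

lemma inner_mf: "mf p M \<bullet> v = (\<Sum>k\<in>{1..q}. p k * (arcmean k M \<bullet> v))"
  by (simp add: mf_def inner_sum_left)

lemma sum_ln_Z_le:
  assumes p: "p \<in> probvec q"
  shows "(\<Sum>k\<in>{1..q}. p k * ln (Z k (M + v))) \<le> (\<Sum>k\<in>{1..q}. p k * ln (Z k M))
     + \<beta> * (mf p M \<bullet> v) + \<beta> * lam * (norm v)\<^sup>2 / 2"
proof -
  have "(\<Sum>k\<in>{1..q}. p k * ln (Z k (M + v)))
      \<le> (\<Sum>k\<in>{1..q}. p k * (ln (Z k M) + \<beta> * (arcmean k M \<bullet> v) + \<beta> * lam * (norm v)\<^sup>2 / 2))"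
    by (intro sum_mono mult_left_mono ln_Z_le probvec_nonneg[OF p])
  also have "\<dots> = (\<Sum>k\<in>{1..q}. p k * ln (Z k M)) + \<beta> * (mf p M \<bullet> v)
      + (\<Sum>k\<in>{1..q}. p k) * (\<beta> * lam * (norm v)\<^sup>2 / 2)"
    unfolding sum_distrib_right
    by (simp add: inner_mf distrib_left sum.distrib sum_distrib_left mult_ac)
  finally show ?thesis using probvec_sum[OF p] by simp
qed

text \<open>At a fixed point the linear term \<open>\<beta> * (mf p M \<bullet> v)\<close> cancels
  the cross term of the square, and the curvature \<open>\<beta> * (1 - lam)\<close>
  remains.\<close>

lemma G_growth:
  assumes p: "p \<in> probvec q" and M: "mf p M = M"
  shows "G p M + \<beta> / 2 * (1 - lam) * (norm (N - M))\<^sup>2 \<le> G p N"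
proof -
  define v where "v = N - M"
  have "(norm (M + v))\<^sup>2 = (norm M)\<^sup>2 + 2 * (M \<bullet> v) + (norm v)\<^sup>2"
    by (simp add: power2_norm_eq_inner inner_add_left inner_add_right inner_commute)
  then have "G p M + \<beta> / 2 * (1 - lam) * (norm v)\<^sup>2 \<le> G p (M + v)"
    using sum_ln_Z_le[OF p, of M v] M by (simp add: G_def algebra_simps)
  then show ?thesis by (simp add: v_def)
qed

text \<open>Expanding from \<open>M\<close> to \<open>N\<close> and from \<open>N\<close> to
  \<open>M\<close> and adding cancels all values of \<open>ln Z\<close>; only the difference of the
  slopes is left.\<close>

lemma mf_mono:
  assumes p: "p \<in> probvec q"
  shows "(mf p N - mf p M) \<bullet> (N - M) \<le> lam * (norm (N - M))\<^sup>2"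
proof -
  have "\<beta> * ((mf p N - mf p M) \<bullet> (N - M)) \<le> \<beta> * (lam * (norm (N - M))\<^sup>2)"
    using sum_ln_Z_le[OF p, of M "N - M"] sum_ln_Z_le[OF p, of N "M - N"]
    by (simp add: inner_diff_left inner_diff_right norm_minus_commute algebra_simps)
  then show ?thesis using beta_pos by simp
qed

lemma norm_arcmean: "norm (arcmean k M) \<le> 1"
proof -
  \<comment> \<open>Testing the barycentre against itself turns a bound on linear forms into a bound
    on the norm.\<close>
  define v where "v = arcmean k M"
  have "integral {lo k..hi k} (\<lambda>\<omega>. (circ \<omega> \<bullet> v) * gw M \<omega>) \<le> integral {lo k..hi k} (\<lambda>\<omega>. norm v * gw M \<omega>)"
  proof (rule integral_le)
    show "(circ x \<bullet> v) * gw M x \<le> norm v * gw M x" for x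
      using norm_cauchy_schwarz[of "circ x" v] gw_pos[of M x] by (intro mult_right_mono) auto
  qed (intro integrable_continuous_real continuous_intros)+
  also have "\<dots> = norm v * Z k M"
    by (simp add: Z_def)
  finally have "v \<bullet> v \<le> norm v"
    using Z_pos[of k M] inner_arcmean[of k M v] unfolding v_def[symmetric] by (simp add: divide_le_eq)
  then have "norm v * norm v \<le> norm v * 1"
    by (simp add: power2_norm_eq_inner[symmetric] power2_eq_square)
  then show ?thesis unfolding v_def[symmetric]
    by (metis mult_le_cancel_left_pos norm_ge_zero order.trans less_eq_real_def zero_le_one)
qed

lemma norm_mf: "p \<in> probvec q \<Longrightarrow> norm (mf p M) \<le> 1"
  unfolding mf_def
proof (rule order.trans[OF sum_norm_le[of _ _ p]])
  show "norm (p k *\<^sub>R arcmean k M) \<le> p k" if "p \<in> probvec q" for k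
    using mult_left_mono[OF norm_arcmean probvec_nonneg[OF that]] probvec_nonneg[OF that] by simp
qed (use probvec_sum[of p q] in simp)

lemma continuous_on_Z: "continuous_on S (Z k)"
  unfolding Z_def[abs_def] box_real(2)[symmetric]
  by (rule integral_continuous_on_param) (auto simp: split_beta intro!: continuous_intros)

lemma continuous_on_ln_Z: "continuous_on S (\<lambda>M. ln (Z k M))"
  using Z_pos by (intro continuous_intros continuous_on_Z) (metis less_irrefl)

lemma continuous_on_arcmean: "continuous_on S (arcmean k)"
proof -
  have "continuous_on S (\<lambda>M. integral {lo k..hi k} (\<lambda>\<omega>. cos \<omega> * gw M \<omega>))"
    "continuous_on S (\<lambda>M. integral {lo k..hi k} (\<lambda>\<omega>. sin \<omega> * gw M \<omega>))"
    unfolding box_real(2)[symmetric]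
    by (rule integral_continuous_on_param; auto simp: split_beta intro!: continuous_intros)+
  then show ?thesis
    unfolding arcmean_def[abs_def] using Z_pos
    by (intro continuous_intros continuous_on_Z) (auto simp: less_imp_neq[symmetric] intro: Z_pos)
qed

lemma continuous_on_mf: "continuous_on S (mf p)"
  unfolding mf_def[abs_def] by (intro continuous_intros continuous_on_arcmean)

section \<open>Existence, uniqueness and continuity of the mean-field vector\<close>

lemma mf_fixed_unique:
  assumes p: "p \<in> probvec q" and "mf p M = M" "mf p N = N"
  shows "M = N"
proof -
  have "(1 - lam) * (norm (N - M))\<^sup>2 \<le> 0"
    using mf_mono[OF p, of N M] assms(2,3) by (simp add: power2_norm_eq_inner algebra_simps)
  then show ?thesis using small by (simp add: mult_le_0_iff)
qed

definition Mstar :: "(nat \<Rightarrow> real) \<Rightarrow> real \<times> real" where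
  "Mstar p = (THE M. mf p M = M)"

text \<open>Existence is taken from Brouwer's theorem on the unit disc, because
  \<open>mf_mono\<close> controls only an inner product and does not by itself make
  \<open>mf p\<close> a contraction.\<close>

lemma mf_Mstar:
  assumes p: "p \<in> probvec q"
  shows "mf p (Mstar p) = Mstar p"
proof -
  have "mf p \<in> cball 0 1 \<rightarrow> cball 0 1"
    using norm_mf[OF p] by (simp add: Pi_iff)
  then obtain M where "mf p M = M"
    using brouwer_ball[OF zero_less_one continuous_on_mf] by blast
  then show ?thesis unfolding Mstar_def
    by (rule theI) (use mf_fixed_unique[OF p] \<open>mf p M = M\<close> in auto)
qed

lemma norm_Mstar: "p \<in> probvec q \<Longrightarrow> norm (Mstar p) \<le> 1"
  using norm_mf[of p "Mstar p"] mf_Mstar[of p] by simp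

text \<open>The change of \<open>mf\<close> splits into a change of the point, absorbed on the left
  through \<open>mf_mono\<close>, and a change of the weights, bounded because the barycentres lie
  in the unit disc.\<close>

lemma Mstar_Lipschitz:
  assumes p: "p \<in> probvec q" and p': "p' \<in> probvec q"
  shows "(1 - lam) * norm (Mstar p - Mstar p') \<le> (\<Sum>k\<in>{1..q}. \<bar>p k - p' k\<bar>)"
proof -
  define v where "v = Mstar p - Mstar p'"
  have "norm (mf p (Mstar p') - mf p' (Mstar p')) = norm (\<Sum>k\<in>{1..q}. (p k - p' k) *\<^sub>R arcmean k (Mstar p'))"
    by (simp add: mf_def sum_subtractf scaleR_diff_left)
  also have "\<dots> \<le> (\<Sum>k\<in>{1..q}. \<bar>p k - p' k\<bar>)"
    by (rule sum_norm_le) (simp add: mult_left_le norm_arcmean)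
  finally have d: "norm (mf p (Mstar p') - mf p' (Mstar p')) \<le> (\<Sum>k\<in>{1..q}. \<bar>p k - p' k\<bar>)" .
  have "norm v * norm v = v \<bullet> v" by (simp add: power2_norm_eq_inner[symmetric] power2_eq_square)
  also have "v \<bullet> v = (mf p (Mstar p) - mf p (Mstar p')) \<bullet> v + (mf p (Mstar p') - mf p' (Mstar p')) \<bullet> v"
    using mf_Mstar[OF p] mf_Mstar[OF p'] by (simp add: inner_diff_left) (simp add: v_def inner_diff_left)
  also have "\<dots> \<le> lam * (norm v)\<^sup>2 + norm (mf p (Mstar p') - mf p' (Mstar p')) * norm v"
    using mf_mono[OF p, of "Mstar p" "Mstar p'"] norm_cauchy_schwarz[of "mf p (Mstar p') - mf p' (Mstar p')" v]
    by (simp add: v_def)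
  also have "\<dots> \<le> lam * (norm v)\<^sup>2 + (\<Sum>k\<in>{1..q}. \<bar>p k - p' k\<bar>) * norm v"
    using d by (simp add: mult_right_mono)
  finally have "((1 - lam) * norm v) * norm v \<le> (\<Sum>k\<in>{1..q}. \<bar>p k - p' k\<bar>) * norm v"
    by (simp add: power2_eq_square algebra_simps)
  then show ?thesis
    unfolding v_def[symmetric]
    by (cases "v = 0") (auto intro: sum_nonneg)
qed

lemma continuous_on_Mstar: "continuous_on (probvec q) Mstar"
  unfolding continuous_on_def
proof
  fix p assume p: "p \<in> probvec q"
  have coord: "((\<lambda>x. x k) \<longlongrightarrow> p k) (at p within probvec q)" for k
    using continuous_on_product_coordinates[of k]
    by (metis UNIV_I at_within_open continuous_on_def open_UNIV tendsto_within_subset subset_UNIV)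
  have "((\<lambda>x. (\<Sum>k\<in>{1..q}. \<bar>x k - p k\<bar>) / (1 - lam)) \<longlongrightarrow> (\<Sum>k\<in>{1..q}. \<bar>p k - p k\<bar>) / (1 - lam)) (at p within probvec q)"
    using small by (intro tendsto_intros coord) auto
  then have "((\<lambda>x. (\<Sum>k\<in>{1..q}. \<bar>x k - p k\<bar>) / (1 - lam)) \<longlongrightarrow> 0) (at p within probvec q)"
    by simp
  moreover have "eventually (\<lambda>x. norm (Mstar x - Mstar p) \<le> (\<Sum>k\<in>{1..q}. \<bar>x k - p k\<bar>) / (1 - lam)) (at p within probvec q)"
    using Mstar_Lipschitz[OF _ p] small
    by (auto simp: eventually_at_filter le_divide_eq mult.commute)
  ultimately have "((\<lambda>x. Mstar x - Mstar p) \<longlongrightarrow> 0) (at p within probvec q)"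
    by (rule Lim_null_comparison[rotated])
  then show "(Mstar \<longlongrightarrow> Mstar p) (at p within probvec q)"
    by (simp add: LIM_zero_iff)
qed

end

subsection \<open>Minimisers on the whole circle\<close>

lemma integral_periodic_shift:
  fixes F :: "real \<Rightarrow> real"
  assumes F: "continuous_on UNIV F" and per: "\<And>x. F (x + 2*pi) = F x" and th: "0 \<le> \<theta>" "\<theta> \<le> 2*pi"
  shows "integral {0..2*pi} (\<lambda>x. F (x + \<theta>)) = integral {0..2*pi} F"
proof -
  have int: "F integrable_on {a..b}" for a b
    by (rule integrable_continuous_real) (rule continuous_on_subset[OF F], simp)
  have sh: "integral {a..b} (\<lambda>x. F (x + c)) = integral {a+c..b+c} F" for a b c
    using integral_shift[of a c b F] continuous_on_subset[OF F] by (simp add: add.commute o_def)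
  have "integral {2*pi..\<theta> + 2*pi} F = integral {0..\<theta>} F"
    using sh[of 0 \<theta> "2*pi"] by (simp add: per)
  moreover have "integral {\<theta>..2*pi} F + integral {2*pi..\<theta> + 2*pi} F = integral {\<theta>..\<theta> + 2*pi} F"
    using th by (intro Henstock_Kurzweil_Integration.integral_combine int) auto
  moreover have "integral {0..\<theta>} F + integral {\<theta>..2*pi} F = integral {0..2*pi} F"
    using th by (intro Henstock_Kurzweil_Integration.integral_combine int) auto
  ultimately show ?thesis using sh[of 0 "2*pi" \<theta>] by (simp add: add.commute)
qed

text \<open>A quotient-free form of the monotonicity of cosh(y a) / cosh(x a) in \<open>a\<close>.
  Twice each product is the cosh of a sum plus the cosh of a difference, and these compare term by
  term.\<close>

lemma cosh_mult_le:
  fixes a b x y :: real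
  assumes "0 \<le> b" "b \<le> a" "0 \<le> x" "x \<le> y"
  shows "cosh (y * b) * cosh (x * a) \<le> cosh (y * a) * cosh (x * b)"
proof -
  have mono: "cosh u \<le> cosh v" if "\<bar>u\<bar> \<le> v" for u v :: real
    using that cosh_real_nonneg_le_iff[of "\<bar>u\<bar>" v] by (simp add: abs_if split: if_splits)
  have 0: "0 \<le> (y - x) * (a - b)" "0 \<le> (y + x) * (a - b)" "0 \<le> (y - x) * (a + b)"
    "0 \<le> y * b" "0 \<le> x * a"
    using assms by auto
  have "cosh (y * b + x * a) \<le> cosh (y * a + x * b)" "cosh (y * b - x * a) \<le> cosh (y * a - x * b)"
    by (rule mono; use 0 in \<open>simp add: abs_le_iff algebra_simps\<close>)+
  then show ?thesis by (simp add: cosh_add cosh_diff)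
qed

text \<open>For \<open>f = 1\<close> and \<open>f = cos\<close> these are 2 pi times the modified
  Bessel functions I_0 and I_1.\<close>

definition bessel :: "(real \<Rightarrow> real) \<Rightarrow> real \<Rightarrow> real" where
  "bessel f x = integral {0..2*pi} (\<lambda>\<omega>. f \<omega> * exp (x * cos \<omega>))"

text \<open>By \<open>bessel_cos\<close> this is I_1(x) / (x I_0(x)) for x other than 0. In this
  form the self-consistency equation for a radius r > 0 reads \<beta> sinvar(\<beta> r) = 1.\<close>

definition sinvar :: "real \<Rightarrow> real" where
  "sinvar x = bessel (\<lambda>\<omega>. (sin \<omega>)\<^sup>2) x / bessel (\<lambda>_. 1) x"

lemma bessel_one_pos: "0 < bessel (\<lambda>_. 1) x"
  unfolding bessel_def by (rule integral_pos_continuous) (auto intro!: continuous_intros)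

lemma bessel_cos: "bessel cos x = x * bessel (\<lambda>\<omega>. (sin \<omega>)\<^sup>2) x"
proof -
  have "((\<lambda>\<omega>. cos \<omega> * exp (x * cos \<omega>) - x * ((sin \<omega>)\<^sup>2 * exp (x * cos \<omega>))) has_integral
      sin (2*pi) * exp (x * cos (2*pi)) - sin 0 * exp (x * cos 0)) {0..2*pi}"
  proof (rule fundamental_theorem_of_calculus)
    fix \<omega> :: real
    show "((\<lambda>\<omega>. sin \<omega> * exp (x * cos \<omega>)) has_vector_derivative
        cos \<omega> * exp (x * cos \<omega>) - x * ((sin \<omega>)\<^sup>2 * exp (x * cos \<omega>))) (at \<omega> within {0..2*pi})"
      unfolding has_real_derivative_iff_has_vector_derivative[symmetric]
      by (auto intro!: derivative_eq_intros simp: power2_eq_square algebra_simps)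
  qed simp
  moreover have "((\<lambda>\<omega>. cos \<omega> * exp (x * cos \<omega>) - x * ((sin \<omega>)\<^sup>2 * exp (x * cos \<omega>))) has_integral
      bessel cos x - x * bessel (\<lambda>\<omega>. (sin \<omega>)\<^sup>2) x) {0..2*pi}"
    unfolding bessel_def
    by (intro has_integral_diff has_integral_mult_right integrable_integral
        integrable_continuous_real continuous_intros)
  ultimately show ?thesis by (auto dest: has_integral_unique)
qed

text \<open>The shift by pi changes the sign of the cosine, so that the weight depends on |cos| only.\<close>
lemma bessel_cosh:
  fixes f :: "real \<Rightarrow> real"
  assumes f: "continuous_on UNIV f" and per: "\<And>\<omega>. f (\<omega> + pi) = f \<omega>"
  shows "bessel f x = integral {0..2*pi} (\<lambda>\<omega>. f \<omega> * cosh (x * cos \<omega>))"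
proof -
  note [continuous_intros] = continuous_on_subset[OF f subset_UNIV]
  have "f (\<omega> + 2 * pi) = f \<omega>" for \<omega> using per[of \<omega>] per[of "\<omega> + pi"] by (simp add: add.assoc)
  then have "bessel f x = integral {0..2*pi} (\<lambda>\<omega>. f (\<omega> + pi) * exp (x * cos (\<omega> + pi)))"
    unfolding bessel_def
    by (intro integral_periodic_shift[symmetric] continuous_intros) (auto intro!: continuous_intros)
  also have "\<dots> = integral {0..2*pi} (\<lambda>\<omega>. f \<omega> * exp (- (x * cos \<omega>)))"
    by (simp add: per)
  finally have 1: "bessel f x = integral {0..2*pi} (\<lambda>\<omega>. f \<omega> * exp (- (x * cos \<omega>)))" .
  have "integral {0..2*pi} (\<lambda>\<omega>. f \<omega> * cosh (x * cos \<omega>))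
      = integral {0..2*pi} (\<lambda>\<omega>. (1/2) * (f \<omega> * exp (x * cos \<omega>)) + (1/2) * (f \<omega> * exp (- (x * cos \<omega>))))"
    by (rule integral_cong) (simp add: cosh_def field_simps)
  also have "\<dots> = (1/2) * bessel f x + (1/2) * integral {0..2*pi} (\<lambda>\<omega>. f \<omega> * exp (- (x * cos \<omega>)))"
    unfolding bessel_def
    by (intro integral_unique has_integral_add has_integral_mult_right integrable_integral
        integrable_continuous_real continuous_intros)
  finally show ?thesis using 1 by simp
qed

lemma bessel_sin_sq_bounds: "0 \<le> bessel (\<lambda>\<omega>. (sin \<omega>)\<^sup>2) x" "bessel (\<lambda>\<omega>. (sin \<omega>)\<^sup>2) x \<le> bessel (\<lambda>_. 1) x"
  unfolding bessel_def
  by (auto intro!: integral_nonneg integral_le integrable_continuous_real continuous_intros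
      simp: abs_square_le_1)

text \<open>Chebyshev's correlation inequality: the ratio of the weights cosh(y|cos|) and cosh(x|cos|)
  increases with |cos|, while the squared sine decreases.\<close>
lemma sinvar_antimono:
  assumes xy: "0 \<le> x" "x \<le> y"
  shows "sinvar y \<le> sinvar x"
proof -
  \<comment> \<open>With this \<open>k\<close> the function k - sin^2 has integral zero under the
    weight at \<open>x\<close>; the claim is that its integral under the weight at \<open>y\<close>
    is nonnegative.\<close>
  define k where "k = sinvar x"
  have k: "0 \<le> k" "k \<le> 1"
    using bessel_sin_sq_bounds[of x] bessel_one_pos[of x] by (auto simp: k_def sinvar_def)
  \<comment> \<open>The threshold for |cos|: k - sin^2 equals cos^2 - a^2 and changes sign where
    |cos| = a.\<close>
  define a where "a = sqrt (1 - k)"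
  have a: "0 \<le> a" "a\<^sup>2 = 1 - k" using k by (auto simp: a_def)
  have eq: "bessel (\<lambda>\<omega>. k - (sin \<omega>)\<^sup>2) z = k * bessel (\<lambda>_. 1) z - bessel (\<lambda>\<omega>. (sin \<omega>)\<^sup>2) z" for z
  proof -
    have "bessel (\<lambda>\<omega>. k - (sin \<omega>)\<^sup>2) z
       = integral {0..2*pi} (\<lambda>\<omega>. k * (1 * exp (z * cos \<omega>)) - (sin \<omega>)\<^sup>2 * exp (z * cos \<omega>))"
      unfolding bessel_def by (rule integral_cong) (simp add: algebra_simps)
    also have "\<dots> = k * bessel (\<lambda>_. 1) z - bessel (\<lambda>\<omega>. (sin \<omega>)\<^sup>2) z"
      unfolding bessel_def
      by (intro integral_unique has_integral_diff has_integral_mult_right integrable_integral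
        integrable_continuous_real continuous_intros)
    finally show ?thesis .
  qed
  have cosh_eq: "bessel (\<lambda>\<omega>. k - (sin \<omega>)\<^sup>2) z = integral {0..2*pi} (\<lambda>\<omega>. (k - (sin \<omega>)\<^sup>2) * cosh (z * cos \<omega>))" for z
    by (rule bessel_cosh) (auto intro!: continuous_intros)
  have 0: "bessel (\<lambda>\<omega>. k - (sin \<omega>)\<^sup>2) x = 0"
    using bessel_one_pos[of x] by (simp add: eq) (simp add: k_def sinvar_def)
  \<comment> \<open>Normalising both weights at the threshold gives the two factors of the integrand
    the same sign on either side of it.\<close>
  have "0 \<le> integral {0..2*pi} (\<lambda>\<omega>. cosh (x * a) * ((k - (sin \<omega>)\<^sup>2) * cosh (y * cos \<omega>))
        - cosh (y * a) * ((k - (sin \<omega>)\<^sup>2) * cosh (x * cos \<omega>)))"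
  proof (rule integral_nonneg)
    fix \<omega> :: real
    have ks: "k - (sin \<omega>)\<^sup>2 = (\<bar>cos \<omega>\<bar>)\<^sup>2 - a\<^sup>2" by (simp add: a sin_squared_eq)
    have abs: "cosh (z * cos \<omega>) = cosh (z * \<bar>cos \<omega>\<bar>)" for z :: real
      by (cases "cos \<omega> \<ge> 0") auto
    have "0 \<le> (k - (sin \<omega>)\<^sup>2) * (cosh (y * cos \<omega>) * cosh (x * a) - cosh (y * a) * cosh (x * cos \<omega>))"
    proof (cases "a \<le> \<bar>cos \<omega>\<bar>")
      case True
      then show ?thesis unfolding ks abs
        using cosh_mult_le[OF a(1) True xy] power_mono[OF True a(1), of 2] by simp
    next
      case False
      then show ?thesis unfolding ks abs
        using cosh_mult_le[of "\<bar>cos \<omega>\<bar>" a x y] power_mono[of "\<bar>cos \<omega>\<bar>" a 2] xy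
        by (intro mult_nonpos_nonpos) auto
    qed
    then show "0 \<le> cosh (x * a) * ((k - (sin \<omega>)\<^sup>2) * cosh (y * cos \<omega>))
        - cosh (y * a) * ((k - (sin \<omega>)\<^sup>2) * cosh (x * cos \<omega>))"
      by (simp add: algebra_simps)
  qed (intro integrable_continuous_real continuous_intros)
  also have "\<dots> = cosh (x * a) * bessel (\<lambda>\<omega>. k - (sin \<omega>)\<^sup>2) y - cosh (y * a) * bessel (\<lambda>\<omega>. k - (sin \<omega>)\<^sup>2) x"
    unfolding cosh_eq
    by (intro integral_unique has_integral_diff has_integral_mult_right integrable_integral
        integrable_continuous_real continuous_intros)
  finally have "0 \<le> bessel (\<lambda>\<omega>. k - (sin \<omega>)\<^sup>2) y"
    using cosh_real_pos[of "x * a"] by (simp add: 0 zero_le_mult_iff)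
  then show ?thesis
    using bessel_one_pos[of y] unfolding eq k_def[symmetric]
    by (simp add: sinvar_def[of y] divide_le_eq)
qed

text \<open>The derivative in r is \<beta> r (1 - \<beta> sinvar(\<beta> r)). The bracket vanishes
  at \<open>r0\<close>, and since \<open>sinvar\<close> decreases it is nonpositive before and
  nonnegative after, so a critical radius is automatically a global minimiser.\<close>

lemma radial_minimum:
  assumes b: "0 < \<beta>" and r0: "0 < r0" and fixed: "bessel cos (\<beta> * r0) = r0 * bessel (\<lambda>_. 1) (\<beta> * r0)" and r: "0 \<le> r"
  shows "\<beta> / 2 * r0\<^sup>2 - ln (bessel (\<lambda>_. 1) (\<beta> * r0)) \<le> \<beta> / 2 * r\<^sup>2 - ln (bessel (\<lambda>_. 1) (\<beta> * r))"
proof -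
  define g where "g r = \<beta> / 2 * r\<^sup>2 - ln (bessel (\<lambda>_. 1) (\<beta> * r))" for r
  have db: "(bessel (\<lambda>_. 1) has_real_derivative bessel cos x) (at x)" for x
    using has_real_derivative_integral_tilt[of 0 "2*pi" "\<lambda>_. 0" cos "\<lambda>_. 1" x]
    unfolding bessel_def[abs_def] by (simp add: continuous_on_cos_real)
  have dg: "(g has_real_derivative \<beta> * r * (1 - \<beta> * sinvar (\<beta> * r))) (at r)" for r
  proof -
    have "((\<lambda>r. bessel (\<lambda>_. 1) (\<beta> * r)) has_real_derivative bessel cos (\<beta> * r) * \<beta>) (at r)"
      by (rule DERIV_chain2[OF db]) (auto intro!: derivative_eq_intros)
    then have "(g has_real_derivative \<beta> / 2 * (2 * r) - bessel cos (\<beta> * r) * \<beta> / bessel (\<lambda>_. 1) (\<beta> * r)) (at r)"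
      unfolding g_def[abs_def] using bessel_one_pos[of "\<beta> * r"]
      by (auto intro!: derivative_eq_intros simp: mult.commute)
    then show ?thesis
      by (simp add: bessel_cos sinvar_def algebra_simps)
  qed
  have s0: "\<beta> * sinvar (\<beta> * r0) = 1"
    using fixed r0 b bessel_one_pos[of "\<beta> * r0"] by (simp add: sinvar_def bessel_cos field_simps)
  have "g r0 \<le> g r"
  proof (cases "r \<le> r0")
    case True
    show ?thesis
    proof (rule DERIV_nonpos_imp_nonincreasing[OF True, of g])
      fix s assume s: "r \<le> s" "s \<le> r0"
      have "sinvar (\<beta> * r0) \<le> sinvar (\<beta> * s)"
        using s r b by (intro sinvar_antimono) auto
      then have "1 \<le> \<beta> * sinvar (\<beta> * s)"
        unfolding s0[symmetric] using b by simp
      then have "\<beta> * s * (1 - \<beta> * sinvar (\<beta> * s)) \<le> 0"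
        using s r b by (intro mult_nonneg_nonpos) auto
      then show "\<exists>y. (g has_real_derivative y) (at s) \<and> y \<le> 0" using dg by blast
    qed
  next
    case False
    then have le: "r0 \<le> r" by simp
    show ?thesis
    proof (rule DERIV_nonneg_imp_nondecreasing[OF le, of g])
      fix s assume s: "r0 \<le> s" "s \<le> r"
      have "sinvar (\<beta> * s) \<le> sinvar (\<beta> * r0)"
        using s r0 b by (intro sinvar_antimono) auto
      then have "\<beta> * sinvar (\<beta> * s) \<le> 1"
        unfolding s0[symmetric] using b by simp
      then have "0 \<le> \<beta> * s * (1 - \<beta> * sinvar (\<beta> * s))"
        using s r0 b by (intro mult_nonneg_nonneg) auto
      then show "\<exists>y. (g has_real_derivative y) (at s) \<and> 0 \<le> y" using dg by blast
    qed
  qed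
  then show ?thesis by (simp add: g_def)
qed

section \<open>Reduction from vectors to radii by rotation\<close>

lemma integral_circle_rotate:
  fixes F :: "real \<Rightarrow> real"
  assumes F: "continuous_on UNIV F"
  shows "integral {0..2*pi} (\<lambda>\<omega>. F (circ \<omega> \<bullet> M)) = integral {0..2*pi} (\<lambda>\<omega>. F (norm M * cos \<omega>))"
proof -
  obtain \<theta> where \<theta>: "0 \<le> \<theta>" "\<theta> < 2*pi" "fst M = norm M * cos \<theta>" "snd M = norm M * sin \<theta>"
  proof (cases "M = 0")
    case True
    then show ?thesis using that[of 0] by simp
  next
    case False
    have "(fst M)\<^sup>2 + (snd M)\<^sup>2 = (norm M)\<^sup>2"
      by (simp add: norm_prod_def)
    then have "(fst M / norm M)\<^sup>2 + (snd M / norm M)\<^sup>2 = 1"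
      using False by (simp add: power_divide flip: add_divide_distrib)
    then obtain t where "0 \<le> t" "t < 2*pi" "fst M / norm M = cos t" "snd M / norm M = sin t"
      by (rule sincos_total_2pi)
    then show ?thesis using False
      by (intro that[of t]) (simp_all add: divide_eq_eq mult.commute)
  qed
  \<comment> \<open>The angle is shifted by 2 pi - \<theta> and not by -\<theta>, since
    \<open>integral_periodic_shift\<close> takes shifts in [0, 2 pi].\<close>
  have dot: "circ \<omega> \<bullet> M = norm M * cos (\<omega> + (2*pi - \<theta>))" for \<omega>
  proof -
    have "cos (\<omega> + (2*pi - \<theta>)) = cos (\<omega> - \<theta>)"
      using cos_periodic[of "\<omega> - \<theta>"] by (simp add: algebra_simps)
    then show ?thesis
      unfolding inner_circ \<theta>(3,4) by (simp add: cos_diff distrib_left mult_ac)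
  qed
  have "continuous_on UNIV (\<lambda>x. F (norm M * cos x))"
    by (rule continuous_on_compose2[OF F]) (auto intro!: continuous_intros)
  then show ?thesis
    unfolding dot using \<theta> by (intro integral_periodic_shift[of "\<lambda>x. F (norm M * cos x)"]) auto
qed

text \<open>After rotation only the length of \<open>M\<close> matters, and so \<open>fixed\<close>
  states the mean-field equation in the direction of \<open>M\<close> alone.\<close>

lemma circle_minimum:
  assumes b: "0 < \<beta>" and M: "M \<noteq> 0"
    and fixed: "integral {0..2*pi} (\<lambda>\<omega>. (circ \<omega> \<bullet> M) * exp (\<beta> * (circ \<omega> \<bullet> M)))
       = (norm M)\<^sup>2 * integral {0..2*pi} (\<lambda>\<omega>. exp (\<beta> * (circ \<omega> \<bullet> M)))"
  shows "\<beta> / 2 * (norm M)\<^sup>2 - ln (integral {0..2*pi} (\<lambda>\<omega>. exp (\<beta> * (circ \<omega> \<bullet> M))))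
    \<le> \<beta> / 2 * (norm N)\<^sup>2 - ln (integral {0..2*pi} (\<lambda>\<omega>. exp (\<beta> * (circ \<omega> \<bullet> N))))"
proof -
  have Z: "integral {0..2*pi} (\<lambda>\<omega>. exp (\<beta> * (circ \<omega> \<bullet> M))) = bessel (\<lambda>_. 1) (\<beta> * norm M)" for M
    using integral_circle_rotate[of "\<lambda>x. exp (\<beta> * x)" M]
    by (simp add: bessel_def continuous_intros mult.assoc)
  have "integral {0..2*pi} (\<lambda>\<omega>. (circ \<omega> \<bullet> M) * exp (\<beta> * (circ \<omega> \<bullet> M)))
      = integral {0..2*pi} (\<lambda>\<omega>. norm M * (cos \<omega> * exp (\<beta> * norm M * cos \<omega>)))"
    using integral_circle_rotate[of "\<lambda>x. x * exp (\<beta> * x)" M]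
    by (simp add: continuous_intros mult.assoc)
  also have "\<dots> = norm M * bessel cos (\<beta> * norm M)" by (simp add: bessel_def)
  finally have "bessel cos (\<beta> * norm M) = norm M * bessel (\<lambda>_. 1) (\<beta> * norm M)"
    using fixed M unfolding Z by (simp add: power2_eq_square)
  then show ?thesis
    unfolding Z using M by (intro radial_minimum[OF b]) auto
qed

subsection \<open>Relative entropy and the minimiser over a fibre\<close>

lemma space_alpha [simp]: "space alpha = {0..<2*pi}"
  by (simp add: alpha_def space_restrict_space)

lemma circle_in_sets_alpha [simp]: "{0..<2*pi} \<in> sets alpha"
  using sets.top[of alpha] by simp

lemma finite_measure_alpha: "finite_measure alpha"
  by (rule finite_measureI) (simp add: alpha_def emeasure_restrict_space space_restrict_space)

lemma borel_measurable_alphaI [measurable (raw)]: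
  "g \<in> borel_measurable borel \<Longrightarrow> g \<in> borel_measurable alpha"
  unfolding alpha_def by (intro measurable_restrict_space1) simp

lemma neg_xlogx_le_1: "0 \<le> x \<Longrightarrow> - xlogx x \<le> 1"
  using ln_le_minus_one[of "1 / x"] by (auto simp: xlogx_def ln_div field_simps)

lemma xlogx_measurable [measurable]: "xlogx \<in> borel_measurable borel"
  unfolding xlogx_def[abs_def] by measurable

text \<open>The negative part of the integrand is at most 1 on a finite measure space, so the
  defining difference never has the form infinity minus infinity and is infinite exactly when the
  positive part is.\<close>

lemma rel_entropy_density:
  assumes \<nu>: "\<nu> = density alpha (\<lambda>x. ennreal (f x))"
    and f [measurable]: "f \<in> borel_measurable alpha" and f0: "\<And>x. 0 \<le> f x"
  shows "rel_entropy \<nu> = (if integrable alpha (\<lambda>x. xlogx (f x)) then ereal (\<integral>x. xlogx (f x) \<partial>alpha) else \<infinity>)"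
proof -
  interpret finite_measure alpha by (rule finite_measure_alpha)
  let ?P = "\<integral>\<^sup>+x. ennreal (xlogx (f x)) \<partial>alpha" and ?N = "\<integral>\<^sup>+x. ennreal (- xlogx (f x)) \<partial>alpha"
  have ac: "absolutely_continuous alpha \<nu>"
    unfolding \<nu> by (rule absolutely_continuousI_density) measurable
  have "AE x in alpha. ennreal (f x) = RN_deriv alpha \<nu> x"
    using \<nu> by (intro RN_deriv_unique) auto
  then have AE: "AE x in alpha. enn2real (RN_deriv alpha \<nu> x) = f x"
    by eventually_elim (metis enn2real_ennreal f0)
  have m0: "ennreal (max 0 x) = ennreal x" for x by (simp add: max_def ennreal_neg)
  have P: "(\<integral>\<^sup>+x. ennreal (max 0 (xlogx (enn2real (RN_deriv alpha \<nu> x)))) \<partial>alpha) = ?P"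
    by (rule nn_integral_cong_AE) (use AE in eventually_elim, simp add: m0)
  have N: "(\<integral>\<^sup>+x. ennreal (max 0 (- xlogx (enn2real (RN_deriv alpha \<nu> x)))) \<partial>alpha) = ?N"
    by (rule nn_integral_cong_AE) (use AE in eventually_elim, simp add: m0)
  have "?N \<le> (\<integral>\<^sup>+x. 1 \<partial>alpha)"
    using neg_xlogx_le_1[OF f0] by (intro nn_integral_mono) (metis ennreal_1 ennreal_leI)
  then have Nfin: "?N \<noteq> \<infinity>"
    using emeasure_finite[of "space alpha"] by (auto simp: top_unique)
  have re: "rel_entropy \<nu> = enn2ereal ?P - enn2ereal ?N"
    unfolding rel_entropy_def P N using ac by simp
  show ?thesis
  proof (cases "?P = \<infinity>")
    case True
    moreover have "\<not> integrable alpha (\<lambda>x. xlogx (f x))"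
      using True by (simp add: real_integrable_def)
    ultimately show ?thesis using Nfin re by (cases ?N rule: ennreal_cases) auto
  next
    case False
    then have int: "integrable alpha (\<lambda>x. xlogx (f x))"
      using Nfin by (simp add: real_integrable_def)
    show ?thesis using False Nfin re int
      by (cases ?N rule: ennreal_cases; cases ?P rule: ennreal_cases)
        (auto simp: real_lebesgue_integral_def[OF int] enn2ereal_ennreal)
  qed
qed

lemma ProbsD:
  assumes "\<nu> \<in> Probs"
  shows "prob_space \<nu>" "sets \<nu> = sets alpha" "space \<nu> = {0..<2*pi}"
  using assms sets_eq_imp_space_eq[of \<nu> alpha] by (auto simp: Probs_def)

lemma Probs_density_exists:
  assumes \<nu>: "\<nu> \<in> Probs" and ac: "absolutely_continuous alpha \<nu>"
  obtains f where "f \<in> borel_measurable alpha" "\<And>x. 0 \<le> f x" "\<nu> = density alpha (\<lambda>x. ennreal (f x))"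
proof -
  interpret finite_measure alpha by (rule finite_measure_alpha)
  interpret \<nu>: prob_space \<nu> using ProbsD[OF \<nu>] by simp
  have RN: "AE x in alpha. RN_deriv alpha \<nu> x \<noteq> \<infinity>"
    using ProbsD[OF \<nu>] ac by (intro RN_deriv_finite) (auto intro: \<nu>.sigma_finite_measure_axioms)
  have "\<nu> = density alpha (RN_deriv alpha \<nu>)"
    using density_RN_deriv[OF ac] ProbsD[OF \<nu>] by simp
  also have "\<dots> = density alpha (\<lambda>x. ennreal (enn2real (RN_deriv alpha \<nu> x)))"
    by (rule density_cong) (use RN in \<open>auto elim!: eventually_mono simp: less_top\<close>)
  finally show ?thesis by (intro that[of "\<lambda>x. enn2real (RN_deriv alpha \<nu> x)"]) auto
qed

lemma Probs_integrable:
  fixes h :: "real \<Rightarrow> real"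
  assumes \<nu>: "\<nu> \<in> Probs" and h: "h \<in> borel_measurable alpha" and B: "\<And>x. x \<in> {0..<2*pi} \<Longrightarrow> \<bar>h x\<bar> \<le> B"
  shows "integrable \<nu> h"
proof -
  interpret \<nu>: prob_space \<nu> using ProbsD[OF \<nu>] by simp
  have "h \<in> borel_measurable \<nu>" using h ProbsD(2)[OF \<nu>] by (simp cong: measurable_cong_sets)
  then show "integrable \<nu> h" using B ProbsD(3)[OF \<nu>] by (intro \<nu>.integrable_const_bound[of _ B]) auto
qed

lemma Probs_integral_density:
  fixes h :: "real \<Rightarrow> real"
  assumes \<nu>: "\<nu> \<in> Probs" and f [measurable]: "f \<in> borel_measurable alpha" and f0: "\<And>x. 0 \<le> f x"
    and d: "\<nu> = density alpha (\<lambda>x. ennreal (f x))"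
    and h [measurable]: "h \<in> borel_measurable alpha" and B: "\<And>x. x \<in> {0..<2*pi} \<Longrightarrow> \<bar>h x\<bar> \<le> B"
  shows "integrable alpha (\<lambda>x. f x * h x)" "(\<integral>x. h x \<partial>\<nu>) = (\<integral>x. f x * h x \<partial>alpha)"
proof -
  have "integrable \<nu> h" using \<nu> h B by (rule Probs_integrable)
  then show "integrable alpha (\<lambda>x. f x * h x)"
    unfolding d using f0 by (subst (asm) integrable_density) auto
  show "(\<integral>x. h x \<partial>\<nu>) = (\<integral>x. f x * h x \<partial>alpha)"
    unfolding d using f0 by (subst integral_density) auto
qed

text \<open>The left-hand side is the tangent of x ln x at \<open>y\<close>; strict convexity gives
  the equality case.\<close>

lemma xlogx_ge:
  assumes x: "0 \<le> x" and y: "0 < y"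
  shows "x * ln y + x - y \<le> xlogx x"
    and "xlogx x = x * ln y + x - y \<Longrightarrow> x = y"
proof -
  have *: "x * (y / x - 1 - ln (y / x)) = xlogx x - (x * ln y + x - y)" if "0 < x"
    using that y by (simp add: xlogx_def ln_div field_simps)
  show "x * ln y + x - y \<le> xlogx x"
  proof (cases "x = 0")
    case False
    then have "0 \<le> x * (y / x - 1 - ln (y / x))"
      using x y ln_le_minus_one[of "y / x"] by (intro mult_nonneg_nonneg) auto
    then show ?thesis using * False x by simp
  qed (use y in \<open>simp add: xlogx_def\<close>)
  show "x = y" if "xlogx x = x * ln y + x - y"
  proof (cases "x = 0")
    case False
    then have "ln (y / x) = y / x - 1" using * x that by simp
    then have "y / x = 1" using x y False by (intro ln_eq_minus_one) auto
    then show ?thesis using False by simp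
  qed (use that y in \<open>simp add: xlogx_def\<close>)
qed

section \<open>Arc indices and integrals over arcs\<close>

context rotor
begin

text \<open>With this map a function that is constant on arcs is written
  \<open>c (kof \<omega>)\<close>, which keeps measurability and integration uniform over the
  arcs.\<close>

definition kof :: "real \<Rightarrow> nat" where
  "kof \<omega> = Suc (nat \<lfloor>\<omega> * q / (2*pi)\<rfloor>)"

lemma arc_eq: "arc q k = {lo k..<hi k}"
  by (simp add: arc_def)

lemma kof_in: "\<omega> \<in> {0..<2*pi} \<Longrightarrow> kof \<omega> \<in> {1..q}"
proof -
  assume \<omega>: "\<omega> \<in> {0..<2*pi}"
  then have "\<omega> * q / (2*pi) < q" using q_pos by (simp add: divide_less_eq)
  then have "\<lfloor>\<omega> * q / (2*pi)\<rfloor> < int q" by linarith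
  then show ?thesis using q_ge_2 by (auto simp: kof_def)
qed

lemma arc_iff_kof:
  assumes \<omega>: "\<omega> \<in> {0..<2*pi}" and k: "1 \<le> k"
  shows "\<omega> \<in> arc q k \<longleftrightarrow> kof \<omega> = k"
proof -
  have "\<omega> \<in> arc q k \<longleftrightarrow> real k - 1 \<le> \<omega> * q / (2*pi) \<and> \<omega> * q / (2*pi) < real k"
    using q_pos by (simp add: arc_def field_simps)
  also have "\<dots> \<longleftrightarrow> \<lfloor>\<omega> * q / (2*pi)\<rfloor> = int k - 1"
    by (simp add: floor_eq_iff)
  also have "\<dots> \<longleftrightarrow> kof \<omega> = k"
    using k \<omega> by (auto simp: kof_def)
  finally show ?thesis .
qed

lemma arc_subset: "k \<in> {1..q} \<Longrightarrow> arc q k \<subseteq> {0..<2*pi}"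
proof -
  assume k: "k \<in> {1..q}"
  then have "2*pi/q * real k \<le> 2*pi/q * real q"
    by (intro mult_left_mono) auto
  moreover have "0 \<le> 2*pi/q * (real k - 1)" using k by auto
  ultimately show ?thesis using q_pos by (auto simp: arc_def)
qed

lemma kof_measurable [measurable]: "kof \<in> borel \<rightarrow>\<^sub>M count_space UNIV"
  unfolding kof_def[abs_def] by measurable

lemma kof_sum:
  fixes c :: "nat \<Rightarrow> real"
  assumes "\<omega> \<in> {0..<2*pi}"
  shows "c (kof \<omega>) = (\<Sum>k\<in>{1..q}. c k * indicator (arc q k) \<omega>)"
proof -
  have "(\<Sum>k\<in>{1..q}. c k * indicator (arc q k) \<omega>) = (\<Sum>k\<in>{1..q}. if kof \<omega> = k then c k else 0)"
    using arc_iff_kof[OF assms] by (intro sum.cong) (auto simp: indicator_def)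
  then show ?thesis using kof_in[OF assms] by simp
qed

lemma alpha_integral_arc:
  fixes g :: "real \<Rightarrow> real"
  assumes g: "continuous_on UNIV g" and k: "k \<in> {1..q}"
  shows "integrable alpha (\<lambda>\<omega>. indicator (arc q k) \<omega> * g \<omega>)"
    and "(\<integral>\<omega>. indicator (arc q k) \<omega> * g \<omega> \<partial>alpha) = integral {lo k..hi k} g"
proof -
  have [measurable]: "g \<in> borel_measurable borel" by (rule borel_measurable_continuous_onI[OF g])
  have S: "set_integrable lborel {lo k..hi k} g"
    using continuous_on_subset[OF g] by (intro borel_integrable_atLeastAtMost') auto
  \<comment> \<open>The half-open arc and the closed interval of the gauge integral differ only in
    this point.\<close>
  have "AE x in lborel. x \<noteq> hi k" by (rule AE_lborel_singleton)
  then have AE: "AE x in lborel. indicator {lo k..hi k} x *\<^sub>R g x = indicator {0..<2*pi} x *\<^sub>R (indicator (arc q k) x * g x)"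
  proof eventually_elim
    case (elim x)
    have "(x \<in> {lo k..hi k}) = (x \<in> arc q k)" "x \<in> arc q k \<Longrightarrow> x \<in> {0..<2*pi}"
      using elim arc_subset[OF k] by (auto simp: arc_eq)
    then show ?case by (auto simp: indicator_def)
  qed
  have [measurable]: "arc q k \<in> sets borel" "{lo k..hi k} \<in> sets borel" by (simp_all add: arc_eq)
  have "integrable lborel (\<lambda>x. indicator {0..<2*pi} x *\<^sub>R (indicator (arc q k) x * g x))"
    using AE by (intro integrable_cong_AE_imp[OF S[unfolded set_integrable_def]]) auto
  then show "integrable alpha (\<lambda>\<omega>. indicator (arc q k) \<omega> * g \<omega>)"
    unfolding alpha_def by (subst integrable_restrict_space) auto
  have "(\<integral>\<omega>. indicator (arc q k) \<omega> * g \<omega> \<partial>alpha)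
      = (\<integral>x. indicator {0..<2*pi} x *\<^sub>R (indicator (arc q k) x * g x) \<partial>lborel)"
    unfolding alpha_def by (subst integral_restrict_space) auto
  also have "\<dots> = (\<integral>x. indicator {lo k..hi k} x *\<^sub>R g x \<partial>lborel)"
    using AE by (intro integral_cong_AE) auto
  also have "\<dots> = integral {lo k..hi k} g"
    using set_borel_integral_eq_integral(2)[OF S] by (simp add: set_lebesgue_integral_def)
  finally show "(\<integral>\<omega>. indicator (arc q k) \<omega> * g \<omega> \<partial>alpha) = integral {lo k..hi k} g" .
qed

lemma alpha_integral_kof:
  fixes g :: "real \<Rightarrow> real" and c :: "nat \<Rightarrow> real"
  assumes g: "continuous_on UNIV g"
  shows "integrable alpha (\<lambda>\<omega>. c (kof \<omega>) * g \<omega>)"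
    and "(\<integral>\<omega>. c (kof \<omega>) * g \<omega> \<partial>alpha) = (\<Sum>k\<in>{1..q}. c k * integral {lo k..hi k} g)"
proof -
  have eq: "c (kof \<omega>) * g \<omega> = (\<Sum>k\<in>{1..q}. c k * (indicator (arc q k) \<omega> * g \<omega>))" if "\<omega> \<in> space alpha" for \<omega>
    using that by (simp only: kof_sum[of \<omega> c] space_alpha sum_distrib_right mult.assoc)
  have i: "integrable alpha (\<lambda>\<omega>. (\<Sum>k\<in>{1..q}. c k * (indicator (arc q k) \<omega> * g \<omega>)))"
    by (intro Bochner_Integration.integrable_sum integrable_mult_right alpha_integral_arc[OF g])
  show "integrable alpha (\<lambda>\<omega>. c (kof \<omega>) * g \<omega>)"
    using i by (subst Bochner_Integration.integrable_cong[OF refl eq])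
  have "(\<integral>\<omega>. c (kof \<omega>) * g \<omega> \<partial>alpha) = (\<integral>\<omega>. (\<Sum>k\<in>{1..q}. c k * (indicator (arc q k) \<omega> * g \<omega>)) \<partial>alpha)"
    by (rule Bochner_Integration.integral_cong[OF refl eq])
  also have "\<dots> = (\<Sum>k\<in>{1..q}. (\<integral>\<omega>. c k * (indicator (arc q k) \<omega> * g \<omega>) \<partial>alpha))"
    by (intro Bochner_Integration.integral_sum integrable_mult_right alpha_integral_arc[OF g])
  also have "\<dots> = (\<Sum>k\<in>{1..q}. c k * integral {lo k..hi k} g)"
    by (intro sum.cong refl) (simp only: integral_mult_right_zero alpha_integral_arc(2)[OF g])
  finally show "(\<integral>\<omega>. c (kof \<omega>) * g \<omega> \<partial>alpha) = (\<Sum>k\<in>{1..q}. c k * integral {lo k..hi k} g)" .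
qed

lemma sum_delta_mult:
  fixes f :: "nat \<Rightarrow> real"
  assumes "finite A" "k \<in> A"
  shows "(\<Sum>j\<in>A. (if j = k then c else 0) * f j) = c * f k"
proof -
  have "(\<Sum>j\<in>A. (if j = k then c else 0) * f j) = (\<Sum>j\<in>A. if j = k then c * f j else 0)"
    by (rule sum.cong) auto
  then show ?thesis using assms by simp
qed

lemma Tmap_probvec:
  assumes \<nu>: "\<nu> \<in> Probs"
  shows "Tmap q \<nu> \<in> probvec q"
    and "integral\<^sup>L \<nu> (\<lambda>\<omega>. c (kof \<omega>)) = (\<Sum>k\<in>{1..q}. c k * Tmap q \<nu> k)"
proof -
  interpret \<nu>: prob_space \<nu> using ProbsD[OF \<nu>] by simp
  have arc: "arc q k \<in> sets \<nu>" if "k \<in> {1..q}" for k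
  proof -
    have "arc q k = {0..<2*pi} \<inter> arc q k" using arc_subset[OF that] by auto
    also have "\<dots> \<in> sets alpha" unfolding alpha_def sets_restrict_space by (rule imageI) (simp add: arc_eq)
    finally show ?thesis using ProbsD[OF \<nu>] by simp
  qed
  have int: "integral\<^sup>L \<nu> (\<lambda>\<omega>. c (kof \<omega>)) = (\<Sum>k\<in>{1..q}. c k * Tmap q \<nu> k)" for c
  proof -
    have "integral\<^sup>L \<nu> (\<lambda>\<omega>. c (kof \<omega>)) = integral\<^sup>L \<nu> (\<lambda>\<omega>. (\<Sum>k\<in>{1..q}. c k * indicator (arc q k) \<omega>))"
      using ProbsD(3)[OF \<nu>] kof_sum[of _ c] by (intro Bochner_Integration.integral_cong) auto
    also have "\<dots> = (\<Sum>k\<in>{1..q}. integral\<^sup>L \<nu> (\<lambda>\<omega>. c k * indicator (arc q k) \<omega>))"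
      using arc by (intro Bochner_Integration.integral_sum integrable_mult_right) (simp add: less_top[symmetric])
    also have "\<dots> = (\<Sum>k\<in>{1..q}. c k * Tmap q \<nu> k)"
      using arc sets.sets_into_space by (intro sum.cong refl) (auto simp: Tmap_def Int_absorb2)
    finally show ?thesis .
  qed
  then show "integral\<^sup>L \<nu> (\<lambda>\<omega>. c (kof \<omega>)) = (\<Sum>k\<in>{1..q}. c k * Tmap q \<nu> k)" .
  show "Tmap q \<nu> \<in> probvec q"
    using int[of "\<lambda>_. 1"] \<nu>.prob_space by (auto simp: probvec_def Tmap_def)
qed

section \<open>Gibbs profiles with prescribed arc masses, and the free-energy identity\<close>

definition fden :: "(nat \<Rightarrow> real) \<Rightarrow> real \<times> real \<Rightarrow> real \<Rightarrow> real" where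
  "fden p M \<omega> = p (kof \<omega>) / Z (kof \<omega>) M * gw M \<omega>"

text \<open>This is \<open>ln (fden p M \<omega>)\<close> on arcs of positive mass. On arcs with
  \<open>p k = 0\<close> the logarithm takes its default value and the function stays bounded, which
  is harmless because a measure with masses \<open>p\<close> does not charge them.\<close>

definition ell :: "(nat \<Rightarrow> real) \<Rightarrow> real \<times> real \<Rightarrow> real \<Rightarrow> real" where
  "ell p M \<omega> = ln (p (kof \<omega>) / Z (kof \<omega>) M) + \<beta> * (circ \<omega> \<bullet> M)"

definition H :: "(nat \<Rightarrow> real) \<Rightarrow> real" where
  "H p = (\<Sum>k\<in>{1..q}. xlogx (p k))"

definition mean :: "real measure \<Rightarrow> real \<times> real" where
  "mean \<nu> = (\<integral>\<omega>. cos \<omega> \<partial>\<nu>, \<integral>\<omega>. sin \<omega> \<partial>\<nu>)"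

lemma Phi_mean: "Phi \<beta> \<nu> = - (\<beta> / 2) * (norm (mean \<nu>))\<^sup>2"
  by (simp add: Phi_def mean_def norm_prod_def)

lemma fden_nonneg: "p \<in> probvec q \<Longrightarrow> 0 \<le> fden p M \<omega>"
  unfolding fden_def using gw_pos[of M \<omega>] Z_pos[of "kof \<omega>" M] probvec_nonneg[of p q] by simp

lemma fden_measurable [measurable]: "fden p M \<in> borel_measurable borel"
proof -
  have [measurable]: "gw M \<in> borel_measurable borel"
    by (rule borel_measurable_continuous_onI) (rule continuous_on_gw)
  show ?thesis unfolding fden_def[abs_def] by measurable
qed

lemma ell_measurable [measurable]: "ell p M \<in> borel_measurable borel"
proof -
  have [measurable]: "(\<lambda>\<omega>. circ \<omega> \<bullet> M) \<in> borel_measurable borel"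
    by (rule borel_measurable_continuous_onI) (intro continuous_intros)
  show ?thesis unfolding ell_def[abs_def] by measurable
qed

lemma fden_integral:
  assumes g: "continuous_on UNIV g"
  shows "integrable alpha (\<lambda>\<omega>. fden p M \<omega> * g \<omega>)"
    and "(\<integral>\<omega>. fden p M \<omega> * g \<omega> \<partial>alpha) = (\<Sum>k\<in>{1..q}. p k * (integral {lo k..hi k} (\<lambda>\<omega>. g \<omega> * gw M \<omega>) / Z k M))"
  using alpha_integral_kof[of "\<lambda>\<omega>. gw M \<omega> * g \<omega>" "\<lambda>k. p k / Z k M"] g
  by (auto simp: fden_def mult.assoc continuous_intros mult.commute[of "gw M _"])

lemma fden_integral_1:
  assumes p: "p \<in> probvec q"
  shows "integrable alpha (fden p M)" "(\<integral>\<omega>. fden p M \<omega> \<partial>alpha) = 1"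
proof -
  show "integrable alpha (fden p M)" using fden_integral(1)[of "\<lambda>_. 1" p M] by simp
  have "(\<integral>\<omega>. fden p M \<omega> \<partial>alpha) = (\<Sum>k\<in>{1..q}. p k * (Z k M / Z k M))"
    using fden_integral(2)[of "\<lambda>_. 1" p M]
    by (simp only: mult_1_left mult_1_right Z_def continuous_on_const simp_thms)
  then show "(\<integral>\<omega>. fden p M \<omega> \<partial>alpha) = 1"
    using probvec_sum[OF p] Z_pos by (simp add: less_imp_neq[symmetric])
qed

lemma fden_Probs:
  fixes M
  assumes p: "p \<in> probvec q"
  defines "\<nu> \<equiv> density alpha (\<lambda>\<omega>. ennreal (fden p M \<omega>))"
  shows "\<nu> \<in> Probs" "Tmap q \<nu> = p" "mean \<nu> = mf p M"
proof -
  have "emeasure \<nu> (space \<nu>) = (\<integral>\<^sup>+\<omega>. ennreal (fden p M \<omega>) \<partial>alpha)"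
    unfolding \<nu>_def by (subst emeasure_density) (auto intro!: nn_integral_cong simp: indicator_def)
  also have "\<dots> = 1"
    using fden_integral_1[OF p, of M] fden_nonneg[OF p] by (subst nn_integral_eq_integral) auto
  finally have "prob_space \<nu>" by (rule prob_spaceI)
  then show P: "\<nu> \<in> Probs" by (simp add: Probs_def \<nu>_def)
  note int = Probs_integral_density(2)[OF P _ fden_nonneg[OF p] \<nu>_def[THEN meta_eq_to_obj_eq], OF borel_measurable_alphaI[OF fden_measurable]]
  have "Tmap q \<nu> k = p k" if k: "k \<in> {1..q}" for k
  proof -
    have [measurable]: "(\<lambda>\<omega>. if kof \<omega> = k then 1 else (0::real)) \<in> borel_measurable borel" by measurable
    have "Tmap q \<nu> k = integral\<^sup>L \<nu> (\<lambda>\<omega>. if kof \<omega> = k then 1 else 0)"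
      using Tmap_probvec(2)[OF P, of "\<lambda>j. if j = k then 1 else 0"] sum_delta_mult[OF _ k, of 1 "Tmap q \<nu>"] by simp
    also have "\<dots> = (\<integral>\<omega>. fden p M \<omega> * (if kof \<omega> = k then 1 else 0) \<partial>alpha)"
      by (rule int[of _ 1]) auto
    also have "\<dots> = (\<integral>\<omega>. (if kof \<omega> = k then p k / Z k M else 0) * gw M \<omega> \<partial>alpha)"
      by (rule Bochner_Integration.integral_cong) (auto simp: fden_def)
    also have "\<dots> = p k / Z k M * Z k M"
      unfolding alpha_integral_kof(2)[OF continuous_on_gw, of "\<lambda>j. if j = k then p k / Z k M else 0"] Z_def[symmetric]
      by (rule sum_delta_mult[OF _ k]) simp
    also have "\<dots> = p k" using Z_pos[of k M] by simp
    finally show ?thesis .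
  qed
  then show "Tmap q \<nu> = p" using probvec_outside[OF p] by (auto simp: fun_eq_iff Tmap_def)
  have "(\<integral>\<omega>. cos \<omega> \<partial>\<nu>) = (\<integral>\<omega>. fden p M \<omega> * cos \<omega> \<partial>alpha)" "(\<integral>\<omega>. sin \<omega> \<partial>\<nu>) = (\<integral>\<omega>. fden p M \<omega> * sin \<omega> \<partial>alpha)"
    by (rule int[of _ 1]; auto intro!: borel_measurable_alphaI)+
  then show "mean \<nu> = mf p M"
    using fden_integral(2)[of cos p M] fden_integral(2)[of sin p M]
    by (simp add: mean_def mf_def arcmean_def prod_eq_iff fst_sum snd_sum continuous_intros)
qed

lemma ell_bounded: "\<exists>B. \<forall>\<omega>. \<omega> \<in> {0..<2*pi} \<longrightarrow> \<bar>ell p M \<omega>\<bar> \<le> B"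
proof (intro exI allI impI)
  fix \<omega> :: real assume "\<omega> \<in> {0..<2*pi}"
  then have "\<bar>ln (p (kof \<omega>) / Z (kof \<omega>) M)\<bar> \<le> (\<Sum>k\<in>{1..q}. \<bar>ln (p k / Z k M)\<bar>)"
    using kof_in by (intro member_le_sum[where f="\<lambda>k. \<bar>ln (p k / Z k M)\<bar>"]) auto
  moreover have "\<bar>\<beta> * (circ \<omega> \<bullet> M)\<bar> \<le> \<beta> * norm M"
    using Cauchy_Schwarz_ineq2[of "circ \<omega>" M] beta_pos by (simp add: abs_mult)
  ultimately show "\<bar>ell p M \<omega>\<bar> \<le> (\<Sum>k\<in>{1..q}. \<bar>ln (p k / Z k M)\<bar>) + \<beta> * norm M"
    unfolding ell_def by linarith
qed

lemma sum_ell: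
  assumes p: "p \<in> probvec q"
  shows "(\<Sum>k\<in>{1..q}. p k * ln (p k / Z k M)) = H p + G p M - \<beta> / 2 * (norm M)\<^sup>2"
proof -
  have "p k * ln (p k / Z k M) = xlogx (p k) - p k * ln (Z k M)" for k
    using Z_pos[of k M] probvec_nonneg[OF p, of k]
    by (cases "p k = 0") (auto simp: xlogx_def ln_div right_diff_distrib)
  then show ?thesis by (simp add: H_def G_def sum_subtractf)
qed

text \<open>The height of x ln x above its tangent at \<open>fden\<close>. Since both densities have
  mass 1, its integral is the relative entropy of the measure with density \<open>f\<close> with
  respect to the Gibbs profile.\<close>

definition gap :: "(nat \<Rightarrow> real) \<Rightarrow> real \<times> real \<Rightarrow> (real \<Rightarrow> real) \<Rightarrow> real \<Rightarrow> real" where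
  "gap p M f \<omega> = xlogx (f \<omega>) - (f \<omega> * ell p M \<omega> + f \<omega> - fden p M \<omega>)"

text \<open>Choosing \<open>M\<close> as the mean of \<nu> itself makes \<beta> <e,M> integrate to
  \<beta> |M|^2. One half of this is the quadratic term of \<open>G\<close>, and the other half
  cancels \<open>Phi\<close> in \<open>FE_density\<close>, so that no square is left over.\<close>

lemma integral_ell:
  assumes \<nu>: "\<nu> \<in> Probs"
  defines "p \<equiv> Tmap q \<nu>" and "M \<equiv> mean \<nu>"
  shows "(\<integral>\<omega>. ell p M \<omega> \<partial>\<nu>) = H p + G p M + \<beta> / 2 * (norm M)\<^sup>2"
proof -
  have p: "p \<in> probvec q" unfolding p_def by (rule Tmap_probvec[OF \<nu>])
  have [measurable]: "(\<lambda>\<omega>. c (kof \<omega>)) \<in> borel_measurable borel" for c :: "nat \<Rightarrow> real" by measurable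
  have i1: "integrable \<nu> (\<lambda>\<omega>. c (kof \<omega>))" for c :: "nat \<Rightarrow> real"
  proof (rule Probs_integrable[OF \<nu>, of _ "\<Sum>k\<in>{1..q}. \<bar>c k\<bar>"])
    show "\<bar>c (kof x)\<bar> \<le> (\<Sum>k\<in>{1..q}. \<bar>c k\<bar>)" if "x \<in> {0..<2*pi}" for x
      using kof_in[OF that] by (intro member_le_sum[where f="\<lambda>k. \<bar>c k\<bar>"]) auto
  qed (intro borel_measurable_alphaI, measurable)
  have i2: "integrable \<nu> cos" "integrable \<nu> sin"
    by (rule Probs_integrable[OF \<nu>, of _ 1]; auto intro!: borel_measurable_alphaI)+
  have "(\<integral>\<omega>. ell p M \<omega> \<partial>\<nu>)
      = (\<integral>\<omega>. ln (p (kof \<omega>) / Z (kof \<omega>) M) + (\<beta> * fst M * cos \<omega> + \<beta> * snd M * sin \<omega>) \<partial>\<nu>)"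
    by (simp add: ell_def[abs_def] inner_circ algebra_simps)
  also have "\<dots> = (\<integral>\<omega>. ln (p (kof \<omega>) / Z (kof \<omega>) M) \<partial>\<nu>) + (\<beta> * fst M * (\<integral>\<omega>. cos \<omega> \<partial>\<nu>) + \<beta> * snd M * (\<integral>\<omega>. sin \<omega> \<partial>\<nu>))"
    using i1[of "\<lambda>k. ln (p k / Z k M)"] i2 by simp
  also have "\<dots> = (\<Sum>k\<in>{1..q}. p k * ln (p k / Z k M)) + \<beta> * (norm M)\<^sup>2"
    unfolding Tmap_probvec(2)[OF \<nu>, of "\<lambda>k. ln (p k / Z k M)"] p_def[symmetric]
    by (simp add: M_def mean_def norm_prod_def power2_eq_square algebra_simps)
  finally show ?thesis unfolding sum_ell[OF p] by (simp add: field_simps)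
qed

lemma FE_density:
  assumes \<nu>: "\<nu> \<in> Probs" and f [measurable]: "f \<in> borel_measurable alpha" and f0: "\<And>x. 0 \<le> f x"
    and d: "\<nu> = density alpha (\<lambda>x. ennreal (f x))"
    and i: "integrable alpha (\<lambda>x. xlogx (f x))"
  defines "p \<equiv> Tmap q \<nu>" and "M \<equiv> mean \<nu>"
  shows "integrable alpha (gap p M f)"
    and "FE \<beta> \<nu> = ereal (H p + G p M + (\<integral>\<omega>. gap p M f \<omega> \<partial>alpha))"
proof -
  interpret \<nu>: prob_space \<nu> using ProbsD[OF \<nu>] by simp
  have p: "p \<in> probvec q" unfolding p_def by (rule Tmap_probvec[OF \<nu>])
  obtain B where B: "\<And>\<omega>. \<omega> \<in> {0..<2*pi} \<Longrightarrow> \<bar>ell p M \<omega>\<bar> \<le> B"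
    using ell_bounded by blast
  have e: "integrable alpha (\<lambda>\<omega>. f \<omega> * ell p M \<omega>)"
    "integral\<^sup>L \<nu> (ell p M) = (\<integral>\<omega>. f \<omega> * ell p M \<omega> \<partial>alpha)"
    using Probs_integral_density[OF \<nu> f f0 d borel_measurable_alphaI[OF ell_measurable] B] by auto
  note one = Probs_integral_density[OF \<nu> f f0 d, of "\<lambda>_. 1" 1]
  show "integrable alpha (gap p M f)"
    unfolding gap_def[abs_def]
    using i e(1) one(1) fden_integral_1(1)[OF p, of M] by simp
  have "(\<integral>\<omega>. gap p M f \<omega> \<partial>alpha) = (\<integral>x. xlogx (f x) \<partial>alpha) - ((\<integral>\<omega>. ell p M \<omega> \<partial>\<nu>) + 1 - 1)"
    unfolding gap_def[abs_def]
    using i e(1) one fden_integral_1[OF p, of M] \<nu>.prob_space by (simp add: e(2))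
  then have "Phi \<beta> \<nu> + (\<integral>x. xlogx (f x) \<partial>alpha) = H p + G p M + (\<integral>\<omega>. gap p M f \<omega> \<partial>alpha)"
    using integral_ell[OF \<nu>] by (simp add: Phi_mean p_def M_def)
  then show "FE \<beta> \<nu> = ereal (H p + G p M + (\<integral>\<omega>. gap p M f \<omega> \<partial>alpha))"
    using rel_entropy_density[OF d f f0] i by (simp add: FE_def)
qed

lemma fden_ln:
  assumes "0 < p (kof \<omega>) / Z (kof \<omega>) M"
  shows "0 < fden p M \<omega>" "ln (fden p M \<omega>) = ell p M \<omega>"
  unfolding fden_def ell_def using assms ln_mult_pos[OF assms gw_pos[of M \<omega>]] mult_pos_pos[OF assms gw_pos[of M \<omega>]]
  by (auto simp: gw_def)

text \<open>The tangent inequality needs a positive \<open>fden\<close>. On arcs of mass zero,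
  marked by \<open>h\<close>, it is replaced by \<open>f = 0\<close> almost everywhere.\<close>

lemma AE_gap:
  assumes \<nu>: "\<nu> \<in> Probs" and f [measurable]: "f \<in> borel_measurable alpha" and f0: "\<And>x. 0 \<le> f x"
    and d: "\<nu> = density alpha (\<lambda>x. ennreal (f x))"
  defines "p \<equiv> Tmap q \<nu>"
  shows "AE \<omega> in alpha. 0 \<le> gap p M f \<omega> \<and> (gap p M f \<omega> = 0 \<longrightarrow> f \<omega> = fden p M \<omega>)"
proof -
  have p: "p \<in> probvec q" unfolding p_def by (rule Tmap_probvec[OF \<nu>])
  define h where "h \<omega> = (if p (kof \<omega>) = 0 then 1 else 0::real)" for \<omega>
  have h_meas: "h \<in> borel_measurable borel" unfolding h_def[abs_def] by measurable
  note hi = Probs_integral_density[OF \<nu> f f0 d borel_measurable_alphaI[OF h_meas], of 1]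
  have "(\<integral>\<omega>. h \<omega> \<partial>\<nu>) = (\<Sum>k\<in>{1..q}. (if p k = 0 then 1 else 0) * p k)"
    unfolding h_def using Tmap_probvec(2)[OF \<nu>, of "\<lambda>k. if p k = 0 then 1 else 0"] by (simp add: p_def)
  also have "\<dots> = 0" by (intro sum.neutral) auto
  finally have "(\<integral>x. f x * h x \<partial>alpha) = 0" using hi(2) by (simp add: h_def)
  moreover have "integrable alpha (\<lambda>x. f x * h x)" using hi(1) by (simp add: h_def)
  ultimately have "AE x in alpha. f x * h x = 0"
    using f0 by (subst integral_nonneg_eq_0_iff_AE[symmetric]) (auto simp: h_def)
  then show ?thesis
  proof eventually_elim
    case (elim \<omega>)
    show ?case
    proof (cases "p (kof \<omega>) = 0")
      case True
      then have "f \<omega> = 0" using elim by (simp add: h_def)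
      then show ?thesis using True by (simp add: gap_def fden_def xlogx_def)
    next
      case False
      then have pos: "0 < p (kof \<omega>) / Z (kof \<omega>) M"
        using probvec_nonneg[OF p, of "kof \<omega>"] Z_pos[of "kof \<omega>" M] by simp
      have "0 < fden p M \<omega>" "ln (fden p M \<omega>) = ell p M \<omega>" using fden_ln[of p \<omega> M] pos by auto
      then show ?thesis
        using xlogx_ge[of "f \<omega>" "fden p M \<omega>"] f0[of \<omega>] by (auto simp: gap_def)
    qed
  qed
qed

text \<open>The equality case is what identifies the fibre minimiser: a vanishing integral of a
  nonnegative gap forces the density.\<close>

lemma FE_lower:
  assumes \<nu>: "\<nu> \<in> Probs"
  defines "p \<equiv> Tmap q \<nu>" and "M \<equiv> mean \<nu>"
  shows "ereal (H p + G p M) \<le> FE \<beta> \<nu>"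
    and "FE \<beta> \<nu> \<le> ereal (H p + G p M) \<Longrightarrow> \<nu> = density alpha (\<lambda>\<omega>. ennreal (fden p M \<omega>))"
proof -
  have "ereal (H p + G p M) \<le> FE \<beta> \<nu> \<and>
    (FE \<beta> \<nu> \<le> ereal (H p + G p M) \<longrightarrow> \<nu> = density alpha (\<lambda>\<omega>. ennreal (fden p M \<omega>)))"
  proof (cases "absolutely_continuous alpha \<nu>")
    case False
    then show ?thesis by (simp add: FE_def rel_entropy_def)
  next
    case True
    then obtain f where f [measurable]: "f \<in> borel_measurable alpha" and f0: "\<And>x. 0 \<le> f x"
      and d: "\<nu> = density alpha (\<lambda>x. ennreal (f x))"
      using Probs_density_exists[OF \<nu>] by blast
    show ?thesis
    proof (cases "integrable alpha (\<lambda>x. xlogx (f x))")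
      case False
      then show ?thesis using rel_entropy_density[OF d f f0] by (simp add: FE_def)
    next
      case True
      note FE = FE_density[OF \<nu> f f0 d True, folded p_def M_def]
      note AE = AE_gap[OF \<nu> f f0 d, of M, folded p_def]
      have "0 \<le> (\<integral>\<omega>. gap p M f \<omega> \<partial>alpha)"
        using AE by (intro integral_nonneg_AE) (auto elim: eventually_mono)
      moreover have "\<nu> = density alpha (\<lambda>\<omega>. ennreal (fden p M \<omega>))" if "(\<integral>\<omega>. gap p M f \<omega> \<partial>alpha) \<le> 0"
      proof -
        have "AE \<omega> in alpha. gap p M f \<omega> = 0"
          using FE(1) AE that \<open>0 \<le> (\<integral>\<omega>. gap p M f \<omega> \<partial>alpha)\<close>
          by (subst integral_nonneg_eq_0_iff_AE[symmetric]) (auto elim: eventually_mono)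
        then have "AE \<omega> in alpha. ennreal (f \<omega>) = ennreal (fden p M \<omega>)"
          using AE by eventually_elim auto
        then show ?thesis unfolding d
          by (intro density_cong) (auto intro: borel_measurable_alphaI)
      qed
      ultimately show ?thesis unfolding FE(2) by simp
    qed
  qed
  then show "ereal (H p + G p M) \<le> FE \<beta> \<nu>"
    "FE \<beta> \<nu> \<le> ereal (H p + G p M) \<Longrightarrow> \<nu> = density alpha (\<lambda>\<omega>. ennreal (fden p M \<omega>))" by blast+
qed

section \<open>Identification of the fibre minimiser and of \<open>Psi'\<close>\<close>

definition V :: "(nat \<Rightarrow> real) \<Rightarrow> real" where
  "V p = H p + G p (Mstar p)"

lemma G_Mstar_le:
  assumes p: "p \<in> probvec q"
  shows "G p (Mstar p) \<le> G p M"
    and "G p M \<le> G p (Mstar p) \<Longrightarrow> M = Mstar p"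
proof -
  have pos: "0 < \<beta> / 2 * (1 - lam)" using beta_pos small by simp
  note gr = G_growth[OF p mf_Mstar[OF p], of M]
  show "G p (Mstar p) \<le> G p M"
    using gr pos by (smt (verit) mult_nonneg_nonneg zero_le_power2)
  show "M = Mstar p" if "G p M \<le> G p (Mstar p)"
  proof -
    have "\<beta> / 2 * (1 - lam) * (norm (M - Mstar p))\<^sup>2 \<le> 0" using gr that by linarith
    then have "\<not> 0 < (norm (M - Mstar p))\<^sup>2"
      using mult_pos_pos[OF pos, of "(norm (M - Mstar p))\<^sup>2"] by linarith
    then show ?thesis by simp
  qed
qed

lemma FE_fden:
  assumes p: "p \<in> probvec q"
  shows "FE \<beta> (density alpha (\<lambda>\<omega>. ennreal (fden p (Mstar p) \<omega>))) = ereal (V p)"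
proof -
  define M where "M = Mstar p"
  define \<nu> where "\<nu> = density alpha (\<lambda>\<omega>. ennreal (fden p M \<omega>))"
  have \<nu>: "\<nu> \<in> Probs" "Tmap q \<nu> = p" "mean \<nu> = M"
    using fden_Probs[OF p, of M] mf_Mstar[OF p] by (auto simp: \<nu>_def M_def)
  have x: "xlogx (fden p M \<omega>) = fden p M \<omega> * ell p M \<omega>" for \<omega>
  proof (cases "p (kof \<omega>) = 0")
    case False
    then have "0 < p (kof \<omega>) / Z (kof \<omega>) M"
      using probvec_nonneg[OF p, of "kof \<omega>"] Z_pos[of "kof \<omega>" M] by simp
    then show ?thesis
      using fden_ln[of p \<omega> M] by (simp add: xlogx_def)
  qed (simp add: xlogx_def fden_def)
  obtain B where B: "\<And>\<omega>. \<omega> \<in> {0..<2*pi} \<Longrightarrow> \<bar>ell p M \<omega>\<bar> \<le> B"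
    using ell_bounded by blast
  have "integrable alpha (\<lambda>\<omega>. xlogx (fden p M \<omega>))"
    unfolding x using B
    by (intro Probs_integral_density(1)[OF \<nu>(1) _ fden_nonneg[OF p] \<nu>_def]) (auto intro: borel_measurable_alphaI)
  from FE_density(2)[OF \<nu>(1) _ fden_nonneg[OF p] \<nu>_def this]
  show ?thesis
    by (simp add: \<nu> gap_def x V_def borel_measurable_alphaI flip: \<nu>_def M_def)
qed

lemma FE_ge_V: "\<nu> \<in> Probs \<Longrightarrow> ereal (V (Tmap q \<nu>)) \<le> FE \<beta> \<nu>"
  using FE_lower(1)[of \<nu>] G_Mstar_le(1)[OF Tmap_probvec(1), of \<nu> "mean \<nu>"]
  by (simp add: V_def) (metis add_left_mono ereal_less_eq(3) order_trans)

lemma nu_of_eq: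
  assumes p: "p \<in> probvec q"
  shows "nu_of \<beta> q p = density alpha (\<lambda>\<omega>. ennreal (fden p (Mstar p) \<omega>))" (is "_ = ?\<nu>")
  unfolding nu_of_def
proof (rule the_equality)
  have \<nu>: "?\<nu> \<in> Probs" "Tmap q ?\<nu> = p" using fden_Probs[OF p] by auto
  then show "?\<nu> \<in> Probs \<and> Tmap q ?\<nu> = p \<and> (\<forall>\<mu>\<in>Probs. Tmap q \<mu> = p \<longrightarrow> FE \<beta> ?\<nu> \<le> FE \<beta> \<mu>)"
    using FE_ge_V FE_fden[OF p] by auto
  fix \<mu> assume \<mu>: "\<mu> \<in> Probs \<and> Tmap q \<mu> = p \<and> (\<forall>\<mu>'\<in>Probs. Tmap q \<mu>' = p \<longrightarrow> FE \<beta> \<mu> \<le> FE \<beta> \<mu>')"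
  then have le: "FE \<beta> \<mu> \<le> ereal (V p)" using \<nu> FE_fden[OF p] by metis
  \<comment> \<open>The mean of the competitor is not known beforehand. Comparison with
    \<open>V p\<close> first forces it to be \<open>Mstar p\<close> by strict convexity of
    \<open>G p\<close>, and then the equality case of \<open>FE_lower\<close> gives the
    measure.\<close>
  have ge: "ereal (H p + G p (mean \<mu>)) \<le> FE \<beta> \<mu>" using FE_lower(1)[of \<mu>] \<mu> by simp
  then have "ereal (H p + G p (mean \<mu>)) \<le> ereal (V p)" using le by (rule order_trans)
  then have m: "mean \<mu> = Mstar p"
    by (intro G_Mstar_le(2)[OF p]) (simp add: V_def)
  then show "\<mu> = ?\<nu>"
    using FE_lower(2)[of \<mu>] \<mu> le by (simp add: V_def)
qed

lemma Mbeta_eq: "p \<in> probvec q \<Longrightarrow> Mbeta \<beta> q p = Mstar p"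
  using fden_Probs(3)[of p "Mstar p"] mf_Mstar[of p] by (simp add: Mbeta_def mean_def nu_of_eq)

text \<open>Off the simplex no measure has these arc masses, so \<open>THE\<close> is applied to the
  same empty predicate for all such vectors. The constant function 2 is just one representative of
  them.\<close>

lemma Mbeta_junk:
  "p \<notin> probvec q \<Longrightarrow> Mbeta \<beta> q p = Mbeta \<beta> q (\<lambda>_. 2)"
proof -
  assume p: "p \<notin> probvec q"
  have junk: "nu_of \<beta> q p = (THE \<nu>. False)" if "p \<notin> probvec q" for p
  proof -
    have "\<nu> \<in> Probs \<Longrightarrow> Tmap q \<nu> \<noteq> p" for \<nu> using Tmap_probvec(1) that by metis
    then show ?thesis unfolding nu_of_def by (intro arg_cong[of _ _ The] ext) blast
  qed
  have "(\<lambda>_. 2) \<notin> probvec q" by (auto simp: probvec_def)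
  from junk[OF p] junk[OF this] show ?thesis by (simp add: Mbeta_def)
qed

lemma ccoef_eq:
  assumes k: "k \<in> {1..q}"
  shows "ccoef \<beta> q k p = gw (Mbeta \<beta> q p) (hi k) / Z k (Mbeta \<beta> q p)"
proof -
  have gw: "exp (\<beta> * (cos \<omega> * fst M + sin \<omega> * snd M)) = gw M \<omega>" for M \<omega>
    by (simp add: gw_def inner_circ)
  show ?thesis
    unfolding ccoef_def Let_def gw alpha_integral_arc(2)[OF continuous_on_gw k] Z_def by simp
qed

section \<open>Continuity and compactness on the simplex\<close>

lemma coordinate_continuous: "continuous_on S (\<lambda>p::nat \<Rightarrow> real. p k)"
  by (rule continuous_on_subset[OF continuous_on_product_coordinates]) simp

lemma continuous_on_xlogx: "continuous_on {0..} xlogx"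
proof -
  have "continuous (at x within {0..}) xlogx" if "0 \<le> x" for x
  proof (cases "x = 0")
    case True
    have "((\<lambda>x::real. x * ln x) \<longlongrightarrow> 0) (at_right 0)" by real_asymp
    then have "(xlogx \<longlongrightarrow> 0) (at_right 0)"
      by (rule Lim_transform_eventually) (auto simp: xlogx_def eventually_at_filter)
    then have "(xlogx \<longlongrightarrow> 0) (at 0 within {0..})"
      by (simp add: at_within_Ici_at_right)
    then show ?thesis using True by (simp add: continuous_within xlogx_def)
  next
    case False
    then have "isCont (\<lambda>x. x * ln x) x" by (intro continuous_intros) auto
    moreover have "eventually (\<lambda>y. y * ln y = xlogx y) (nhds x)"
      using t1_space_nhds[OF False] by (auto simp: xlogx_def elim: eventually_mono)
    ultimately have "isCont xlogx x" using isCont_cong[of "\<lambda>x. x * ln x" xlogx x] by blast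
    then show ?thesis by (rule continuous_at_imp_continuous_at_within)
  qed
  then show ?thesis by (simp add: continuous_on_eq_continuous_within)
qed

lemma continuous_on_H: "continuous_on (probvec q) H"
  unfolding H_def[abs_def]
  by (intro continuous_on_sum continuous_on_compose2[OF continuous_on_xlogx] coordinate_continuous)
    (auto simp: probvec_nonneg)

lemma continuous_on_ln_Z_Mstar: "continuous_on (probvec q) (\<lambda>p. ln (Z k (Mstar p)))"
  by (rule continuous_on_compose2[OF continuous_on_ln_Z continuous_on_Mstar]) auto

lemma continuous_on_V: "continuous_on (probvec q) V"
  unfolding V_def[abs_def] G_def
  by (intro continuous_intros continuous_on_H continuous_on_Mstar coordinate_continuous continuous_on_ln_Z_Mstar)

lemma closed_coordinate:
  fixes a :: real
  shows "closed {p::nat \<Rightarrow> real. a \<le> p k}" "closed {p::nat \<Rightarrow> real. p k = a}"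
  using coordinate_continuous[of UNIV k]
  by (auto intro!: closed_Collect_le closed_Collect_eq continuous_intros)

text \<open>Vectors are functions on all of \<open>nat\<close> with the product topology, so
  compactness comes from Tychonoff's theorem for the cube and the closedness of the coordinate
  conditions.\<close>

lemma compact_probvec: "compact (probvec q)"
proof -
  have sub: "probvec q \<subseteq> PiE UNIV (\<lambda>_. {0..1})"
    using probvec_nonneg probvec_le_1 by (auto simp: PiE_def)
  have "compact (PiE UNIV (\<lambda>_. {0..1::real}) :: (nat \<Rightarrow> real) set)"
    using compactin_PiE[of "\<lambda>_. euclidean" UNIV "\<lambda>_::nat. {0..1::real}"]
    by (simp add: euclidean_product_topology)
  moreover have "closed (probvec q)"
  proof -
    have "probvec q = (\<Inter>k. {p. 0 \<le> p k}) \<inter> (\<Inter>k\<in>-{1..q}. {p. p k = 0}) \<inter> {p. (\<Sum>k\<in>{1..q}. p k) = 1}"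
      by (auto simp: probvec_def)
    moreover have "closed {p::nat \<Rightarrow> real. (\<Sum>k\<in>{1..q}. p k) = 1}"
      by (intro closed_Collect_eq continuous_intros coordinate_continuous)
    ultimately show ?thesis by (auto intro!: closed_Int closed_INT closed_coordinate)
  qed
  ultimately show ?thesis using sub by (metis compact_Int_closed inf.absorb_iff2)
qed

lemma uniform_probvec: "uniform q \<in> probvec q"
  using q_pos by (auto simp: probvec_def uniform_def)

lemma V_bounded_below: "\<exists>b. \<forall>p\<in>probvec q. b \<le> V p"
  using continuous_attains_inf[OF compact_probvec _ continuous_on_V] uniform_probvec by blast

text \<open>The infimum subtracted in \<open>Psi\<close> must be a real number for the order of the
  values to survive: \<open>V\<close> is bounded below by compactness, and the uniform vector gives
  a finite upper bound.\<close>

lemma Psi'_eq: "\<exists>c. \<forall>p\<in>probvec q. Psi' \<beta> q p = ereal (V p - c)"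
proof -
  obtain b where b: "\<And>p. p \<in> probvec q \<Longrightarrow> b \<le> V p" using V_bounded_below by blast
  have "ereal b \<le> (INF \<mu>\<in>Probs. FE \<beta> \<mu>)"
  proof (rule INF_greatest)
    fix \<mu> assume "\<mu> \<in> Probs"
    then show "ereal b \<le> FE \<beta> \<mu>"
      using FE_ge_V[of \<mu>] b[OF Tmap_probvec(1)[of \<mu>]] by (metis ereal_less_eq(3) order_trans)
  qed
  moreover have "(INF \<mu>\<in>Probs. FE \<beta> \<mu>) \<le> ereal (V (uniform q))"
    using FE_fden[OF uniform_probvec] fden_Probs(1)[OF uniform_probvec] by (metis INF_lower)
  ultimately obtain c where "(INF \<mu>\<in>Probs. FE \<beta> \<mu>) = ereal c"
    by (cases "INF \<mu>\<in>Probs. FE \<beta> \<mu>") auto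
  then show ?thesis
    by (intro exI[of _ c]) (simp add: Psi'_def Psi_def nu_of_eq FE_fden)
qed

end

subsection \<open>The flow\<close>

text \<open>The squared negative part is differentiable across 0 and can serve as a test function
  for the sign of the coordinates.\<close>

lemma has_real_derivative_min_0_sq:
  "((\<lambda>x. (min 0 x)\<^sup>2) has_real_derivative 2 * min 0 x) (at x)"
proof -
  consider "x < 0" | "x > 0" | "x = 0" by linarith
  then show ?thesis
  proof cases
    case 1
    have "((\<lambda>x. x\<^sup>2) has_real_derivative 2 * x) (at x)" by (auto intro!: derivative_eq_intros)
    then have "((\<lambda>x. (min 0 x)\<^sup>2) has_real_derivative 2 * x) (at x)"
      by (rule has_field_derivative_transform_within_open[of _ _ _ "{..<0}"]) (use 1 in auto)
    then show ?thesis using 1 by simp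
  next
    case 2
    have "((\<lambda>x. 0) has_real_derivative 0) (at x)" by simp
    then have "((\<lambda>x. (min 0 x)\<^sup>2) has_real_derivative 0) (at x)"
      by (rule has_field_derivative_transform_within_open[of _ _ _ "{0<..}"]) (use 2 in auto)
    then show ?thesis using 2 by simp
  next
    case 3
    have "((\<lambda>h::real. (min 0 h)\<^sup>2 / h) \<longlongrightarrow> 0) (at 0)"
    proof (rule Lim_null_comparison)
      have "norm ((min 0 h)\<^sup>2 / h) \<le> \<bar>h\<bar>" for h :: real
        by (cases "h < 0") (auto simp: min_def power2_eq_square abs_if)
      then show "eventually (\<lambda>h. norm ((min 0 h)\<^sup>2 / h) \<le> \<bar>h\<bar>) (at 0)" by simp
      show "((\<lambda>h::real. \<bar>h\<bar>) \<longlongrightarrow> 0) (at 0)" by (auto intro: tendsto_eq_intros)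
    qed
    then show ?thesis using 3 by (simp add: DERIV_def)
  qed
qed

text \<open>At the left end only continuity is asked, so that time 0, where the trajectory may lie
  on the boundary of the simplex, is allowed.\<close>

lemma nonincreasing_of_deriv_nonpos:
  fixes f :: "real \<Rightarrow> real"
  assumes st: "0 \<le> s" "s \<le> t" and cont: "continuous_on {0..} f"
    and d: "\<And>x. s < x \<Longrightarrow> (f has_real_derivative f' x) (at x within {0..})"
    and neg: "\<And>x. s < x \<Longrightarrow> f' x \<le> 0"
  shows "f t \<le> f s"
proof (rule DERIV_nonpos_imp_decreasing_open[OF st(2)])
  fix x assume x: "s < x" "x < t"
  then have "at x within {0..} = at x" using st by (intro at_within_interior) auto
  then show "\<exists>y. (f has_real_derivative y) (at x) \<and> y \<le> 0" using d[OF x(1)] neg[OF x(1)] by auto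
qed (use cont st in \<open>auto intro: continuous_on_subset\<close>)

lemma prevq_bij: "1 \<le> q \<Longrightarrow> bij_betw (prevq q) {1..q} {1..q}"
  by (rule bij_betwI[of _ _ _ "\<lambda>k. if k = q then 1 else k + 1"]) (auto simp: prevq_def)

lemma sum_prevq: "1 \<le> q \<Longrightarrow> (\<Sum>k\<in>{1..q}. f (prevq q k)) = (\<Sum>k\<in>{1..q}. f k)"
  by (rule sum.reindex_bij_betw[OF prevq_bij])

lemma prevq_in: "k \<in> {1..q} \<Longrightarrow> prevq q k \<in> {1..q}"
  by (auto simp: prevq_def)

lemma prevq_reach:
  assumes "j \<in> {1..q}" "k \<in> {1..q}"
  shows "\<exists>i\<le>q. (prevq q ^^ i) j = k"
proof -
  have down: "i < m \<Longrightarrow> (prevq q ^^ i) m = m - i" for i m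
    by (induction i) (auto simp: prevq_def)
  show ?thesis
  proof (cases "k \<le> j")
    case True
    then show ?thesis using down[of "j - k" j] assms by (intro exI[of _ "j - k"]) auto
  next
    case False
    \<comment> \<open>Going down from \<open>j\<close> to 1 takes j - 1 steps, and one more wraps
      around to \<open>q\<close>; since j < k the total count stays below \<open>q\<close>.\<close>
    have "(prevq q ^^ j) j = q"
      using down[of "j - 1" j] assms(1) by (cases j) (auto simp: prevq_def)
    then have "(prevq q ^^ ((q - k) + j)) j = k"
      unfolding funpow_add comp_def using down[of "q - k" q] assms by simp
    then show ?thesis using False assms by (intro exI[of _ "(q - k) + j"]) auto
  qed
qed

lemma sum_Fvec:
  assumes "1 \<le> q"
  shows "(\<Sum>k\<in>{1..q}. Fvec \<beta> q p k) = 0"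
  using sum_prevq[OF assms, of "\<lambda>k. ccoef \<beta> q k p * p k"] by (simp add: Fvec_def sum_subtractf)

section \<open>Bounds for the jump rates on and off the simplex\<close>

context rotor
begin

lemma ccoef_bounds: "\<exists>c C. 0 < c \<and> (\<forall>p. \<forall>k\<in>{1..q}. c \<le> ccoef \<beta> q k p \<and> ccoef \<beta> q k p \<le> C)"
proof -
  \<comment> \<open>The mean-field vector lies in the unit disc on the simplex and takes one fixed
    default value elsewhere, so a single radius covers all \<open>p\<close>.\<close>
  define R where "R = max 1 (norm (Mbeta \<beta> q (\<lambda>_. 2)))"
  have R: "norm (Mbeta \<beta> q p) \<le> R" for p
    using norm_Mstar[of p] Mbeta_eq[of p] Mbeta_junk[of p] by (cases "p \<in> probvec q") (auto simp: R_def)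
  have gwb: "exp (- (\<beta> * R)) \<le> gw M \<omega>" "gw M \<omega> \<le> exp (\<beta> * R)" if "norm M \<le> R" for M \<omega>
  proof -
    have "\<bar>circ \<omega> \<bullet> M\<bar> \<le> R" using Cauchy_Schwarz_ineq2[of "circ \<omega>" M] that by simp
    then have "- R \<le> circ \<omega> \<bullet> M" "circ \<omega> \<bullet> M \<le> R" by auto
    then show "exp (- (\<beta> * R)) \<le> gw M \<omega>" "gw M \<omega> \<le> exp (\<beta> * R)"
      using beta_pos mult_left_mono[of "-R" "circ \<omega> \<bullet> M" \<beta>] by (auto simp: gw_def)
  qed
  define l where "l = 2 * pi / q"
  have l: "0 < l" using q_pos by (simp add: l_def)
  have len: "hi k - lo k = l" for k using q_pos by (simp add: l_def field_simps)
  have Zb: "l * exp (- (\<beta> * R)) \<le> Z k M" "Z k M \<le> l * exp (\<beta> * R)" if "norm M \<le> R" for k M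
  proof -
    have i: "gw M integrable_on {lo k..hi k}" by (intro integrable_continuous_real continuous_intros)
    have "integral {lo k..hi k} (\<lambda>_. exp (- (\<beta> * R))) \<le> Z k M"
      "Z k M \<le> integral {lo k..hi k} (\<lambda>_. exp (\<beta> * R))"
      unfolding Z_def
      by (rule integral_le[OF integrable_const_ivl i gwb(1)[OF that]],
          rule integral_le[OF i integrable_const_ivl gwb(2)[OF that]])
    then show "l * exp (- (\<beta> * R)) \<le> Z k M" "Z k M \<le> l * exp (\<beta> * R)"
      using lo_less_hi[of k] len[of k] by (simp_all only: integral_const_real content_real scaleR_conv_of_real) auto
  qed
  show ?thesis
  proof (rule exI[of _ "exp (- (\<beta> * R)) / (l * exp (\<beta> * R))"],
      rule exI[of _ "exp (\<beta> * R) / (l * exp (- (\<beta> * R)))"], intro conjI allI ballI)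
    fix p k assume k: "k \<in> {1..q}"
    show "exp (- (\<beta> * R)) / (l * exp (\<beta> * R)) \<le> ccoef \<beta> q k p"
      unfolding ccoef_eq[OF k] by (intro frac_le less_imp_le[OF gw_pos] gwb[OF R] Z_pos Zb[OF R])
    show "ccoef \<beta> q k p \<le> exp (\<beta> * R) / (l * exp (- (\<beta> * R)))"
      unfolding ccoef_eq[OF k] by (intro frac_le gwb[OF R] Zb[OF R]) (use l in auto)
  qed (use l in simp)
qed

lemma Fvec_in:
  "k \<in> {1..q} \<Longrightarrow> Fvec \<beta> q p k = ccoef \<beta> q (prevq q k) p * p (prevq q k) - ccoef \<beta> q k p * p k"
  by (simp add: Fvec_def)

end

locale rotor_flow = rotor +
  fixes \<phi> :: "real \<Rightarrow> nat \<Rightarrow> real"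
  assumes init: "\<phi> 0 \<in> probvec q"
    and flow: "\<And>t k. t \<ge> 0 \<Longrightarrow>
           ((\<lambda>s. \<phi> s k) has_real_derivative Fvec \<beta> q (\<phi> t) k) (at t within {0..})"
begin

lemma flow_continuous: "continuous_on {0..} (\<lambda>s. \<phi> s k)"
  by (rule DERIV_continuous_on) (rule flow, simp)

text \<open>Off the simplex the minimiser defining the vector field does not exist and Mbeta is a junk
  constant. The rates are positive and bounded there too, so the usual argument for the invariance
  of the simplex applies.\<close>
lemma flow_nonneg:
  assumes t: "0 \<le> t" and k: "k \<in> {1..q}"
  shows "0 \<le> \<phi> t k"
proof -
  obtain c C where c: "0 < c" and cC: "\<And>p k. k \<in> {1..q} \<Longrightarrow> c \<le> ccoef \<beta> q k p \<and> ccoef \<beta> q k p \<le> C"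
    using ccoef_bounds by blast
  define n where "n t k = min 0 (\<phi> t k)" for t k
  \<comment> \<open>\<open>N\<close> measures the negative parts. It starts at 0, and Gronwall's
    inequality will keep it there.\<close>
  define N where "N t = (\<Sum>k\<in>{1..q}. (n t k)\<^sup>2)" for t
  define N' where "N' t = (\<Sum>k\<in>{1..q}. 2 * n t k * Fvec \<beta> q (\<phi> t) k)" for t
  have dN: "(N has_real_derivative N' t) (at t within {0..})" if "0 \<le> t" for t
    unfolding N_def[abs_def] N'_def n_def
    by (intro DERIV_sum DERIV_chain2[OF has_real_derivative_min_0_sq] flow that)
  have N': "N' t \<le> 2 * C * N t" for t
  proof -
    have "2 * n t k * Fvec \<beta> q (\<phi> t) k \<le> C * ((n t k)\<^sup>2 + (n t (prevq q k))\<^sup>2)" if k: "k \<in> {1..q}" for k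
    proof -
      let ?j = "prevq q k"
      have cj: "0 \<le> ccoef \<beta> q ?j (\<phi> t)" "ccoef \<beta> q ?j (\<phi> t) \<le> C" and ck: "0 \<le> ccoef \<beta> q k (\<phi> t)"
        using cC[OF prevq_in[OF k], of "\<phi> t"] cC[OF k, of "\<phi> t"] c by auto
      have n0: "n t i \<le> 0" "n t i \<le> \<phi> t i" "n t i * \<phi> t i = (n t i)\<^sup>2" for i
        by (auto simp: n_def min_def power2_eq_square)
      \<comment> \<open>Replacing the inflow by its negative part lowers it, and the nonpositive
        factor \<open>n t k\<close> reverses the inequality.\<close>
      have "n t k * (ccoef \<beta> q ?j (\<phi> t) * \<phi> t ?j) \<le> n t k * (ccoef \<beta> q ?j (\<phi> t) * n t ?j)"
        using n0 cj by (intro mult_left_mono_neg mult_left_mono) auto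
      also have "\<dots> = ccoef \<beta> q ?j (\<phi> t) * (n t k * n t ?j)" by simp
      also have "\<dots> \<le> C * (n t k * n t ?j)"
        using cj n0 by (intro mult_right_mono mult_nonpos_nonpos) auto
      also have "\<dots> \<le> C * (((n t k)\<^sup>2 + (n t ?j)\<^sup>2) / 2)"
        using sum_squares_bound[of "n t k" "n t ?j"] cj by (intro mult_left_mono) auto
      finally have 1: "n t k * (ccoef \<beta> q ?j (\<phi> t) * \<phi> t ?j) \<le> C * (((n t k)\<^sup>2 + (n t ?j)\<^sup>2) / 2)" .
      have eq: "n t k * (ccoef \<beta> q k (\<phi> t) * \<phi> t k) = ccoef \<beta> q k (\<phi> t) * (n t k)\<^sup>2"
        unfolding n0(3)[symmetric] by (rule mult.left_commute)
      have 2: "0 \<le> n t k * (ccoef \<beta> q k (\<phi> t) * \<phi> t k)" unfolding eq using ck by simp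
      show ?thesis using 1 2 unfolding Fvec_in[OF k] by (simp add: algebra_simps)
    qed
    then have "N' t \<le> (\<Sum>k\<in>{1..q}. C * ((n t k)\<^sup>2 + (n t (prevq q k))\<^sup>2))"
      unfolding N'_def by (intro sum_mono)
    also have "\<dots> = C * (N t + (\<Sum>k\<in>{1..q}. (n t (prevq q k))\<^sup>2))"
      by (simp add: N_def sum.distrib flip: sum_distrib_left)
    also have "(\<Sum>k\<in>{1..q}. (n t (prevq q k))\<^sup>2) = N t"
      unfolding N_def using q_ge_2 by (intro sum_prevq[where f="\<lambda>k. (n t k)\<^sup>2"]) auto
    finally show ?thesis by (simp add: algebra_simps)
  qed
  define f where "f t = N t * exp (- (2 * C * t))" for t
  have df: "(f has_real_derivative (N' t - 2 * C * N t) * exp (- (2 * C * t))) (at t within {0..})" if "0 \<le> t" for t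
    unfolding f_def[abs_def]
    by (rule DERIV_cong[OF DERIV_mult[OF dN[OF that] DERIV_chain2[OF DERIV_exp, where Db="- (2 * C)"]]])
      (auto intro!: derivative_eq_intros simp: algebra_simps)
  have "f t \<le> f 0"
  proof (rule nonincreasing_of_deriv_nonpos[of 0 t f "\<lambda>t. (N' t - 2 * C * N t) * exp (- (2 * C * t))"])
    show "continuous_on {0..} f" by (rule DERIV_continuous_on) (rule df, simp)
    show "(N' t - 2 * C * N t) * exp (- (2 * C * t)) \<le> 0" for t
      using N'[of t] by (intro mult_nonpos_nonneg) auto
  qed (use df t in auto)
  also have "f 0 = 0"
    using probvec_nonneg[OF init] by (simp add: f_def N_def n_def)
  finally have "N t \<le> 0" by (simp add: f_def mult_le_0_iff)
  moreover have "(n t k)\<^sup>2 \<le> N t"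
    unfolding N_def using k by (intro member_le_sum) auto
  ultimately have "(n t k)\<^sup>2 \<le> 0" by linarith
  then show ?thesis by (simp add: n_def min_def split: if_splits)
qed

lemma flow_probvec:
  assumes t: "0 \<le> t"
  shows "\<phi> t \<in> probvec q"
proof -
  have const: "f t = f 0" if "\<And>t. 0 \<le> t \<Longrightarrow> (f has_real_derivative 0) (at t within {0..})" for f :: "real \<Rightarrow> real"
    using has_field_derivative_zero_constant[of "{0..}" f] that t by force
  have out: "\<phi> t k = 0" if k: "k \<notin> {1..q}" for k
  proof -
    have "Fvec \<beta> q x k = 0" for x by (simp only: Fvec_def k if_False)
    then show ?thesis
      using const[of "\<lambda>s. \<phi> s k"] flow[of _ k] probvec_outside[OF init k] by simp
  qed
  have "((\<lambda>s. \<Sum>k\<in>{1..q}. \<phi> s k) has_real_derivative 0) (at t within {0..})" if "0 \<le> t" for t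
  proof -
    have "((\<lambda>s. \<Sum>k\<in>{1..q}. \<phi> s k) has_real_derivative (\<Sum>k\<in>{1..q}. Fvec \<beta> q (\<phi> t) k)) (at t within {0..})"
      by (intro DERIV_sum flow that)
    then show ?thesis using sum_Fvec[of q] q_ge_2 by simp
  qed
  from const[OF this] have "(\<Sum>k\<in>{1..q}. \<phi> t k) = 1" using probvec_sum[OF init] by simp
  moreover have "0 \<le> \<phi> t k" for k using out[of k] flow_nonneg[OF t, of k] by (cases "k \<in> {1..q}") auto
  ultimately show ?thesis using out by (simp add: probvec_def)
qed

text \<open>The integrating factor exp(C t) absorbs the outflow. The rescaled coordinates
  \<open>z\<close> are then nondecreasing and grow at a rate at least \<open>c\<close> times their
  predecessor, which itself does not decrease.\<close>

lemma flow_spread: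
  assumes \<tau>: "0 < \<tau>"
  obtains \<kappa> where "0 < \<kappa>" "\<And>s j. 0 \<le> s \<Longrightarrow> j \<in> {1..q} \<Longrightarrow> \<kappa> * \<phi> s j \<le> \<phi> (s + \<tau>) j"
    "\<And>s j. 0 \<le> s \<Longrightarrow> j \<in> {1..q} \<Longrightarrow> \<kappa> * \<phi> s (prevq q j) \<le> \<phi> (s + \<tau>) j"
proof -
  obtain c C where c: "0 < c" and cC: "\<And>p k. k \<in> {1..q} \<Longrightarrow> c \<le> ccoef \<beta> q k p \<and> ccoef \<beta> q k p \<le> C"
    using ccoef_bounds by blast
  define z where "z k t = \<phi> t k * exp (C * t)" for k t
  define z' where "z' k t = (Fvec \<beta> q (\<phi> t) k + C * \<phi> t k) * exp (C * t)" for k t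
  have dz: "(z k has_real_derivative z' k t) (at t within {0..})" if "0 \<le> t" for k t
    unfolding z_def[abs_def] z'_def
    by (rule DERIV_cong[OF DERIV_mult[OF flow[OF that] DERIV_chain2[OF DERIV_exp, where Db=C]]])
      (auto intro!: derivative_eq_intros simp: algebra_simps)
  have z': "c * z (prevq q k) t \<le> z' k t" "0 \<le> c * z (prevq q k) t" if t: "0 \<le> t" and k: "k \<in> {1..q}" for k t
  proof -
    let ?j = "prevq q k"
    have nn: "0 \<le> \<phi> t i" for i using probvec_nonneg[OF flow_probvec[OF t]] .
    have "c * \<phi> t ?j \<le> ccoef \<beta> q ?j (\<phi> t) * \<phi> t ?j" "ccoef \<beta> q k (\<phi> t) * \<phi> t k \<le> C * \<phi> t k"
      using cC[OF k] cC[OF prevq_in[OF k]] nn by (auto intro!: mult_right_mono)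
    then have "c * \<phi> t ?j \<le> Fvec \<beta> q (\<phi> t) k + C * \<phi> t k" unfolding Fvec_in[OF k] by simp
    then show "c * z ?j t \<le> z' k t" unfolding z_def z'_def mult.assoc[symmetric]
      by (rule mult_right_mono) simp
    show "0 \<le> c * z ?j t" using c nn by (simp add: z_def)
  qed
  note z'0 = order_trans[OF z'(2) z'(1)]
  have contz: "continuous_on {0..} (z k)" for k by (rule DERIV_continuous_on) (use dz in auto)
  have zmono: "z k s \<le> z k t" if "0 \<le> s" "s \<le> t" "k \<in> {1..q}" for k s t
  proof -
    have "- z k t \<le> - z k s"
      using that by (intro nonincreasing_of_deriv_nonpos[where f="\<lambda>t. - z k t" and f'="\<lambda>t. - z' k t"])
        (auto intro!: DERIV_minus dz z'0 continuous_intros contz)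
    then show ?thesis by simp
  qed
  have zgain: "c * \<tau> * z (prevq q k) s \<le> z k (s + \<tau>)" if s: "0 \<le> s" and k: "k \<in> {1..q}" for k s
  proof -
    define w where "w t = t * (c * z (prevq q k) s) - z k t" for t
    have "w (s + \<tau>) \<le> w s"
    proof (rule nonincreasing_of_deriv_nonpos[where f=w and f'="\<lambda>t. 1 * (c * z (prevq q k) s) - z' k t"])
      show "continuous_on {0..} w" unfolding w_def[abs_def] by (intro continuous_intros contz)
      fix x assume x: "s < x"
      show "(w has_real_derivative 1 * (c * z (prevq q k) s) - z' k x) (at x within {0..})"
        unfolding w_def[abs_def] using s x by (intro DERIV_diff DERIV_cmult_right DERIV_ident dz) auto
      have "c * z (prevq q k) s \<le> c * z (prevq q k) x"
        using zmono[OF s _ prevq_in[OF k], of x] x c by simp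
      then show "1 * (c * z (prevq q k) s) - z' k x \<le> 0" using z'(1)[of x k] s x k by simp
    qed (use s \<tau> in auto)
    moreover have "0 \<le> z k s" using probvec_nonneg[OF flow_probvec[OF s]] by (simp add: z_def)
    ultimately show ?thesis by (simp add: w_def algebra_simps)
  qed
  \<comment> \<open>The minimum serves both claims, with gain 1 for staying and
    \<open>c * \<tau>\<close> for moving one arc; the exponential undoes the integrating
    factor.\<close>
  define \<kappa> where "\<kappa> = min 1 (c * \<tau>) * exp (- (C * \<tau>))"
  have shift: "\<kappa> * x \<le> y" if "min 1 (c * \<tau>) * (x * exp (C * s)) \<le> y * exp (C * (s + \<tau>))" for x y s
  proof -
    have "min 1 (c * \<tau>) * (x * exp (C * s)) * exp (- (C * (s + \<tau>))) \<le> y * exp (C * (s + \<tau>)) * exp (- (C * (s + \<tau>)))"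
      by (rule mult_right_mono[OF that]) simp
    moreover have "exp (C * s) * exp (- (C * (s + \<tau>))) = exp (- (C * \<tau>))"
      "exp (C * (s + \<tau>)) * exp (- (C * (s + \<tau>))) = 1"
      by (simp_all add: algebra_simps flip: exp_add)
    ultimately show ?thesis by (simp add: \<kappa>_def mult.assoc) (simp add: mult_ac)
  qed
  show ?thesis
  proof (rule that[of \<kappa>])
    show "0 < \<kappa>" using c \<tau> by (simp add: \<kappa>_def)
    fix s :: real and j assume s: "0 \<le> s" and j: "j \<in> {1..q}"
    have zn: "0 \<le> z k s" for k using probvec_nonneg[OF flow_probvec[OF s]] by (simp add: z_def)
    have "min 1 (c * \<tau>) * z j s \<le> 1 * z j s" using zn by (intro mult_right_mono) auto
    also have "\<dots> \<le> z j (s + \<tau>)" using zmono[OF s _ j] \<tau> by simp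
    finally show "\<kappa> * \<phi> s j \<le> \<phi> (s + \<tau>) j" by (intro shift) (simp add: z_def)
    have "min 1 (c * \<tau>) * z (prevq q j) s \<le> c * \<tau> * z (prevq q j) s" using zn by (intro mult_right_mono) auto
    also have "\<dots> \<le> z j (s + \<tau>)" by (rule zgain[OF s j])
    finally show "\<kappa> * \<phi> s (prevq q j) \<le> \<phi> (s + \<tau>) j" by (intro shift) (simp add: z_def)
  qed
qed

text \<open>At time t - q \<tau> some arc carries mass at least 1/q, and \<open>q\<close> steps of
  length \<tau> suffice to transport a fixed share of it to any other arc. Small \<tau> gives
  positivity at every positive time, and \<tau> = 1 a uniform bound from time \<open>q\<close>
  on.\<close>

lemma flow_uniformly_positive:
  assumes \<tau>: "0 < \<tau>"
  obtains \<delta> where "0 < \<delta>" "\<And>t j. real q * \<tau> \<le> t \<Longrightarrow> j \<in> {1..q} \<Longrightarrow> \<delta> \<le> \<phi> t j"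
proof -
  obtain \<kappa> where \<kappa>: "0 < \<kappa>" and stay: "\<And>s j. 0 \<le> s \<Longrightarrow> j \<in> {1..q} \<Longrightarrow> \<kappa> * \<phi> s j \<le> \<phi> (s + \<tau>) j"
    and move: "\<And>s j. 0 \<le> s \<Longrightarrow> j \<in> {1..q} \<Longrightarrow> \<kappa> * \<phi> s (prevq q j) \<le> \<phi> (s + \<tau>) j"
    using flow_spread[OF \<tau>] by metis
  \<comment> \<open>Of the \<open>n\<close> steps, \<open>i\<close> move to the next arc and the
    others stay.\<close>
  have it: "\<kappa> ^ n * \<phi> s ((prevq q ^^ i) j) \<le> \<phi> (s + real n * \<tau>) j"
    if "0 \<le> s" "i \<le> n" "j \<in> {1..q}" for n i s j
    using that
  proof (induction n arbitrary: i j)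
    case (Suc n)
    have s': "0 \<le> s + real n * \<tau>" using Suc.prems \<tau> by simp
    have eq: "s + real (Suc n) * \<tau> = s + real n * \<tau> + \<tau>" by (simp add: algebra_simps)
    show ?case
    proof (cases "i \<le> n")
      case True
      have "\<kappa> ^ Suc n * \<phi> s ((prevq q ^^ i) j) \<le> \<kappa> * \<phi> (s + real n * \<tau>) j"
        using Suc.IH[OF _ True Suc.prems(3)] Suc.prems \<kappa> by (simp add: mult.assoc)
      also have "\<dots> \<le> \<phi> (s + real (Suc n) * \<tau>) j" unfolding eq by (rule stay[OF s' Suc.prems(3)])
      finally show ?thesis .
    next
      case False
      then have i: "i = Suc n" using Suc.prems by simp
      have "\<kappa> ^ Suc n * \<phi> s ((prevq q ^^ i) j) \<le> \<kappa> * \<phi> (s + real n * \<tau>) (prevq q j)"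
        using Suc.IH[of n "prevq q j"] prevq_in[OF Suc.prems(3)] Suc.prems \<kappa>
        by (simp add: i mult.assoc funpow_swap1)
      also have "\<dots> \<le> \<phi> (s + real (Suc n) * \<tau>) j" unfolding eq by (rule move[OF s' Suc.prems(3)])
      finally show ?thesis .
    qed
  qed simp
  show ?thesis
  proof (rule that[of "\<kappa> ^ q * (1 / q)"])
    show "0 < \<kappa> ^ q * (1 / q)" using \<kappa> q_pos by simp
    fix t j assume t: "real q * \<tau> \<le> t" and j: "j \<in> {1..q}"
    define s where "s = t - real q * \<tau>"
    have s: "0 \<le> s" using t by (simp add: s_def)
    obtain k where k: "k \<in> {1..q}" "1 / q \<le> \<phi> s k"
    proof (rule ccontr)
      assume "\<not> thesis"
      then have "\<And>k. k \<in> {1..q} \<Longrightarrow> \<phi> s k < 1 / q" using that by force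
      then have "(\<Sum>k\<in>{1..q}. \<phi> s k) < (\<Sum>k\<in>{1..q}. 1 / real q)" using q_ge_2 by (intro sum_strict_mono) auto
      then show False using probvec_sum[OF flow_probvec[OF s]] q_pos by simp
    qed
    obtain i where i: "i \<le> q" "(prevq q ^^ i) j = k" using prevq_reach[OF j k(1)] by blast
    have "\<kappa> ^ q * (1 / q) \<le> \<kappa> ^ q * \<phi> s k" using k \<kappa> by (intro mult_left_mono) auto
    also have "\<dots> \<le> \<phi> (s + real q * \<tau>) j" using it[OF s i(1) j] i(2) by simp
    finally show "\<kappa> ^ q * (1 / q) \<le> \<phi> t j" by (simp add: s_def)
  qed
qed

lemma flow_pos:
  assumes t: "0 < t" and j: "j \<in> {1..q}"
  shows "0 < \<phi> t j"
proof -
  have "0 < t / q" using t q_pos by simp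
  then obtain \<delta> where "0 < \<delta>" "\<And>t' j. real q * (t / q) \<le> t' \<Longrightarrow> j \<in> {1..q} \<Longrightarrow> \<delta> \<le> \<phi> t' j"
    using flow_uniformly_positive by metis
  then show ?thesis using q_pos j by force
qed

end

subsection \<open>Dissipation\<close>

context rotor
begin

lemma sum_arcs:
  fixes g :: "real \<Rightarrow> real"
  assumes g: "continuous_on UNIV g"
  shows "(\<Sum>k\<in>{1..q}. integral {lo k..hi k} g) = integral {0..2*pi} g"
proof -
  have int: "g integrable_on {a..b}" for a b
    by (rule integrable_continuous_real) (rule continuous_on_subset[OF g], simp)
  have "(\<Sum>k\<in>{1..n}. integral {lo k..hi k} g) = integral {0..hi n} g" for n
  proof (induction n)
    case (Suc n)
    have "integral {0..hi n} g + integral {hi n..hi (Suc n)} g = integral {0..hi (Suc n)} g"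
      using q_pos by (intro Henstock_Kurzweil_Integration.integral_combine int) (auto intro: mult_left_mono divide_right_mono)
    then show ?case using Suc.IH by simp
  qed simp
  from this[of q] show ?thesis using q_pos by simp
qed

text \<open>Each term is the limit of the density of nu^p at the right end of an arc, taken from
  inside that arc.\<close>

lemma Fvec_Mstar:
  assumes p: "p \<in> probvec q" and k: "k \<in> {1..q}"
  shows "Fvec \<beta> q p k = gw (Mstar p) (hi (prevq q k)) * (p (prevq q k) / Z (prevq q k) (Mstar p))
      - gw (Mstar p) (hi k) * (p k / Z k (Mstar p))"
  unfolding Fvec_in[OF k] ccoef_eq[OF k] ccoef_eq[OF prevq_in[OF k]] Mbeta_eq[OF p] by simp

lemma gw_prevq:
  assumes k: "k \<in> {1..q}"
  shows "gw M (hi (prevq q k)) = gw M (lo k)"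
proof (cases "k = 1")
  case True
  \<comment> \<open>The wrap-around: arc \<open>q\<close> ends at 2 pi and arc 1 starts at 0, the
    same point of the circle.\<close>
  then show ?thesis using q_pos by (simp add: prevq_def gw_def circ_def)
next
  case False
  then show ?thesis using k by (simp add: prevq_def of_nat_diff)
qed

text \<open>The increments of the weight are integrals of its derivative, which is the weight times the
  inner product of the position with the rotated vector. The latter is orthogonal to the
  mean-field vector itself.\<close>
lemma sum_increments_zero:
  assumes p: "p \<in> probvec q"
  shows "(\<Sum>k\<in>{1..q}. p k / Z k (Mstar p) * (gw (Mstar p) (hi k) - gw (Mstar p) (lo k))) = 0"
proof -
  define M where "M = Mstar p"
  define M' where "M' = (snd M, - fst M)"
  have "gw M (hi k) - gw M (lo k) = \<beta> * (Z k M * (arcmean k M \<bullet> M'))" for k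
  proof -
    have "((\<lambda>\<omega>. \<beta> * ((circ \<omega> \<bullet> M') * gw M \<omega>)) has_integral gw M (hi k) - gw M (lo k)) {lo k..hi k}"
    proof (rule fundamental_theorem_of_calculus)
      show "lo k \<le> hi k" using lo_less_hi[of k] by simp
      show "(gw M has_vector_derivative \<beta> * ((circ \<omega> \<bullet> M') * gw M \<omega>)) (at \<omega> within {lo k..hi k})" for \<omega>
        unfolding has_real_derivative_iff_has_vector_derivative[symmetric] gw_def[abs_def] inner_circ M'_def
        by (auto intro!: derivative_eq_intros simp: algebra_simps)
    qed
    then have "gw M (hi k) - gw M (lo k) = \<beta> * integral {lo k..hi k} (\<lambda>\<omega>. (circ \<omega> \<bullet> M') * gw M \<omega>)"
      unfolding integral_mult_right[symmetric] by (rule integral_unique[symmetric])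
    then show ?thesis unfolding inner_arcmean using Z_pos[of k M] by simp
  qed
  then have "(\<Sum>k\<in>{1..q}. p k / Z k M * (gw M (hi k) - gw M (lo k))) = (\<Sum>k\<in>{1..q}. \<beta> * (p k * (arcmean k M \<bullet> M')))"
    using Z_pos by (intro sum.cong) (auto simp: less_imp_neq[symmetric])
  also have "\<dots> = \<beta> * (mf p M \<bullet> M')" by (simp add: inner_mf sum_distrib_left)
  also have "\<dots> = 0" using mf_Mstar[OF p] by (simp add: M_def[symmetric] M'_def inner_prod_def)
  finally show ?thesis by (simp add: M_def)
qed

text \<open>Minus the derivative of \<open>V\<close> along the field: \<open>H\<close> contributes
  ln p_k + 1, the envelope theorem contributes -ln Z_k, and the constant 1 drops out because the
  field sums to zero.\<close>

definition diss :: "(nat \<Rightarrow> real) \<Rightarrow> real" where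
  "diss p = - (\<Sum>k\<in>{1..q}. Fvec \<beta> q p k * ln (p k / Z k (Mstar p)))"

lemma mult_ln_quotient_ge:
  fixes x y :: real
  assumes "0 < x" "0 < y"
  shows "x - y \<le> x * (ln x - ln y)" and "x * (ln x - ln y) = x - y \<Longrightarrow> x = y"
  using xlogx_ge[of x y] assms by (auto simp: xlogx_def algebra_simps)

lemma diss_nonneg:
  assumes p: "p \<in> probvec q" and pos: "\<And>k. k \<in> {1..q} \<Longrightarrow> 0 < p k"
  shows "0 \<le> diss p"
    and "diss p = 0 \<Longrightarrow> k \<in> {1..q} \<Longrightarrow> p k / Z k (Mstar p) = p (prevq q k) / Z (prevq q k) (Mstar p)"
proof -
  define a where "a k = p k / Z k (Mstar p)" for k
  define g where "g k = gw (Mstar p) (hi k)" for k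
  have a: "0 < a k" if "k \<in> {1..q}" for k using pos[OF that] Z_pos by (simp add: a_def)
  have g: "0 < g k" for k by (simp add: g_def gw_pos)
  have q1: "1 \<le> q" using q_ge_2 by simp
  \<comment> \<open>The defect of the tangent inequality between neighbouring values, weighted by
    the boundary weight. Summation by parts around the circle turns the linear terms into the sum of
    a_k (g_k - g_(k-1)), which vanishes by \<open>sum_increments_zero\<close>.\<close>
  define d where "d k = g (prevq q k) * (a (prevq q k) * (ln (a (prevq q k)) - ln (a k)) - (a (prevq q k) - a k))" for k
  have "diss p = - (\<Sum>k\<in>{1..q}. (g (prevq q k) * a (prevq q k) - g k * a k) * ln (a k))"
    unfolding diss_def by (intro arg_cong[of _ _ uminus] sum.cong) (auto simp: Fvec_Mstar[OF p] a_def g_def)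
  also have "\<dots> = (\<Sum>k\<in>{1..q}. g k * a k * ln (a k)) - (\<Sum>k\<in>{1..q}. g (prevq q k) * a (prevq q k) * ln (a k))"
    by (simp add: left_diff_distrib sum_subtractf)
  also have "(\<Sum>k\<in>{1..q}. g k * a k * ln (a k)) = (\<Sum>k\<in>{1..q}. g (prevq q k) * a (prevq q k) * ln (a (prevq q k)))"
    by (rule sum_prevq[OF q1, where f="\<lambda>k. g k * a k * ln (a k)", symmetric])
  also have "\<dots> - (\<Sum>k\<in>{1..q}. g (prevq q k) * a (prevq q k) * ln (a k))
      = (\<Sum>k\<in>{1..q}. d k) + (\<Sum>k\<in>{1..q}. g (prevq q k) * a (prevq q k)) - (\<Sum>k\<in>{1..q}. g (prevq q k) * a k)"
    unfolding d_def by (simp add: algebra_simps sum.distrib sum_subtractf)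
  also have "(\<Sum>k\<in>{1..q}. g (prevq q k) * a (prevq q k)) = (\<Sum>k\<in>{1..q}. g k * a k)"
    by (rule sum_prevq[OF q1, where f="\<lambda>k. g k * a k"])
  also have "(\<Sum>k\<in>{1..q}. d k) + (\<Sum>k\<in>{1..q}. g k * a k) - (\<Sum>k\<in>{1..q}. g (prevq q k) * a k)
      = (\<Sum>k\<in>{1..q}. d k) + (\<Sum>k\<in>{1..q}. a k * (g k - g (prevq q k)))"
    by (simp add: algebra_simps sum_subtractf)
  also have "(\<Sum>k\<in>{1..q}. a k * (g k - g (prevq q k))) = 0"
  proof -
    have "(\<Sum>k\<in>{1..q}. a k * (g k - g (prevq q k)))
       = (\<Sum>k\<in>{1..q}. p k / Z k (Mstar p) * (gw (Mstar p) (hi k) - gw (Mstar p) (lo k)))"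
      by (intro sum.cong refl) (simp only: a_def g_def gw_prevq)
    then show ?thesis using sum_increments_zero[OF p] by simp
  qed
  finally have eq: "diss p = (\<Sum>k\<in>{1..q}. d k)" by simp
  have d0: "0 \<le> d k" if "k \<in> {1..q}" for k
    using mult_ln_quotient_ge(1)[OF a[OF prevq_in[OF that]] a[OF that]] g[of "prevq q k"] by (simp add: d_def)
  show "0 \<le> diss p" unfolding eq by (intro sum_nonneg d0)
  show "p k / Z k (Mstar p) = p (prevq q k) / Z (prevq q k) (Mstar p)" if "diss p = 0" "k \<in> {1..q}"
  proof -
    have "d k = 0" using that d0 unfolding eq by (subst (asm) sum_nonneg_eq_0_iff) auto
    then have "a (prevq q k) = a k"
      using mult_ln_quotient_ge(2)[OF a[OF prevq_in[OF that(2)]] a[OF that(2)]] g[of "prevq q k"] by (simp add: d_def)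
    then show ?thesis by (simp add: a_def)
  qed
qed

text \<open>The relative entropy of \<open>p\<close> with respect to the vector Z_k / S is
  nonnegative, \<open>S\<close> being the sum of the Z_k. The bound is the functional of the whole
  circle, evaluated at \<open>Mstar p\<close>.\<close>

lemma V_lower:
  assumes p: "p \<in> probvec q"
  shows "\<beta> / 2 * (norm (Mstar p))\<^sup>2 - ln (\<Sum>k\<in>{1..q}. Z k (Mstar p)) \<le> V p"
proof -
  define M where "M = Mstar p"
  define S where "S = (\<Sum>k\<in>{1..q}. Z k M)"
  have S: "0 < S" unfolding S_def using q_ge_2 Z_pos by (intro sum_pos) auto
  have "(\<Sum>k\<in>{1..q}. p k * ln (Z k M) - p k * ln S + p k - Z k M / S) \<le> (\<Sum>k\<in>{1..q}. xlogx (p k))"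
  proof (rule sum_mono)
    fix k
    have "0 < Z k M / S" using Z_pos S by simp
    from xlogx_ge(1)[OF probvec_nonneg[OF p] this]
    show "p k * ln (Z k M) - p k * ln S + p k - Z k M / S \<le> xlogx (p k)"
      using Z_pos[of k M] S by (simp add: ln_div right_diff_distrib)
  qed
  also have "(\<Sum>k\<in>{1..q}. p k * ln (Z k M) - p k * ln S + p k - Z k M / S)
     = (\<Sum>k\<in>{1..q}. p k * ln (Z k M)) - (\<Sum>k\<in>{1..q}. p k) * ln S + (\<Sum>k\<in>{1..q}. p k) - S / S"
    unfolding S_def sum_distrib_right sum_divide_distrib by (simp add: sum.distrib sum_subtractf)
  finally show ?thesis
    unfolding V_def H_def G_def M_def[symmetric] S_def[symmetric] using probvec_sum[OF p] S by simp
qed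

text \<open>Equal a_k make \<open>p\<close> proportional to Z_k(M), so the pieces on the arcs join
  to one Gibbs density on the circle, with mean \<open>M\<close>. If \<open>M\<close> is not 0, then
  \<open>V p\<close> attains the bound of \<open>V_lower\<close>, and \<open>circle_minimum\<close>
  compares this bound with the one at any other vector.\<close>

lemma critical_point:
  assumes p: "p \<in> probvec q" and pos: "\<And>k. k \<in> {1..q} \<Longrightarrow> 0 < p k" and d: "diss p = 0"
  shows "p = uniform q \<or> (\<forall>p'\<in>probvec q. V p \<le> V p')"
proof -
  define M where "M = Mstar p"
  define a where "a = p q / Z q M"
  have qq: "q \<in> {1..q}" using q_ge_2 by simp
  have it: "p ((prevq q ^^ i) q) / Z ((prevq q ^^ i) q) M = a \<and> (prevq q ^^ i) q \<in> {1..q}" for i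
  proof (induction i)
    case (Suc i)
    then show ?case
      using diss_nonneg(2)[OF p pos d, of "(prevq q ^^ i) q"] prevq_in[of "(prevq q ^^ i) q" q]
      by (simp add: M_def del: atLeastAtMost_iff)
  qed (use qq in \<open>simp add: a_def\<close>)
  have pk: "p k = a * Z k M" if "k \<in> {1..q}" for k
    using prevq_reach[OF qq that] it Z_pos[of k M] by (metis less_irrefl nonzero_eq_divide_eq)
  have gwS: "(\<Sum>k\<in>{1..q}. Z k M) = integral {0..2*pi} (gw M)" for M
    unfolding Z_def by (rule sum_arcs) (rule continuous_on_gw)
  define S where "S = (\<Sum>k\<in>{1..q}. Z k M)"
  have S: "0 < S" unfolding S_def using q_ge_2 Z_pos by (intro sum_pos) auto
  have "1 = (\<Sum>k\<in>{1..q}. a * Z k M)" unfolding probvec_sum[OF p, symmetric] by (intro sum.cong pk) auto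
  then have aS: "a * S = 1" by (simp add: S_def sum_distrib_left)
  then have a: "a = 1 / S" using S by (simp add: field_simps)
  show ?thesis
  proof (cases "M = 0")
    case True
    have Z: "Z k M = 2 * pi / q" for k
    proof -
      have "Z k M = integral {lo k..hi k} (\<lambda>_. 1)" by (simp add: Z_def gw_def[abs_def] True)
      also have "\<dots> = hi k - lo k" using lo_less_hi[of k] by simp
      also have "\<dots> = 2 * pi / q" using q_pos by (simp add: field_simps)
      finally show ?thesis .
    qed
    then have "S = 2 * pi" using q_pos by (simp add: S_def)
    then have "p k = uniform q k" for k
      using pk[of k] probvec_outside[OF p, of k] by (cases "k \<in> {1..q}") (auto simp: uniform_def Z a)
    then show ?thesis by auto
  next
    case False
    have "(norm M)\<^sup>2 = mf p M \<bullet> M" using mf_Mstar[OF p] by (simp add: M_def power2_norm_eq_inner)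
    also have "\<dots> = (\<Sum>k\<in>{1..q}. a * integral {lo k..hi k} (\<lambda>\<omega>. (circ \<omega> \<bullet> M) * gw M \<omega>))"
      unfolding inner_mf inner_arcmean using Z_pos by (intro sum.cong) (auto simp: pk less_imp_neq[symmetric] simp del: atLeastAtMost_iff)
    also have "\<dots> = a * integral {0..2*pi} (\<lambda>\<omega>. (circ \<omega> \<bullet> M) * gw M \<omega>)"
      unfolding sum_distrib_left[symmetric] by (subst sum_arcs) (auto intro!: continuous_intros)
    finally have "integral {0..2*pi} (\<lambda>\<omega>. (circ \<omega> \<bullet> M) * gw M \<omega>) = (norm M)\<^sup>2 * S"
      using S by (simp add: a)
    then have min: "\<beta> / 2 * (norm M)\<^sup>2 - ln S \<le> \<beta> / 2 * (norm N)\<^sup>2 - ln (\<Sum>k\<in>{1..q}. Z k N)" for N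
      using circle_minimum[OF beta_pos False, of N] unfolding S_def gwS gw_def by simp
    have "V p = \<beta> / 2 * (norm M)\<^sup>2 + (\<Sum>k\<in>{1..q}. p k * ln (p k / Z k M))"
      unfolding sum_ell[OF p] by (simp add: V_def M_def)
    also have "(\<Sum>k\<in>{1..q}. p k * ln (p k / Z k M)) = (\<Sum>k\<in>{1..q}. p k * ln a)"
      using Z_pos by (intro sum.cong refl) (simp add: pk less_imp_neq[symmetric] del: atLeastAtMost_iff)
    also have "\<dots> = - ln S"
      unfolding sum_distrib_right[symmetric] probvec_sum[OF p] using S by (simp add: a ln_div)
    finally have "V p = \<beta> / 2 * (norm M)\<^sup>2 - ln S" by simp
    then have "\<forall>p'\<in>probvec q. V p \<le> V p'"
      using min V_lower by (metis order_trans)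
    then show ?thesis by blast
  qed
qed

lemma continuous_on_Fvec: "continuous_on (probvec q) (\<lambda>p. Fvec \<beta> q p k)"
proof (cases "k \<in> {1..q}")
  case True
  have Zc: "continuous_on (probvec q) (\<lambda>p. Z j (Mstar p))" for j
    by (rule continuous_on_compose2[OF continuous_on_Z continuous_on_Mstar]) auto
  have "continuous_on (probvec q) (\<lambda>p. gw (Mstar p) (hi (prevq q k)) * (p (prevq q k) / Z (prevq q k) (Mstar p))
      - gw (Mstar p) (hi k) * (p k / Z k (Mstar p)))"
    using Z_pos by (intro continuous_intros continuous_on_Mstar coordinate_continuous Zc)
      (auto simp: less_imp_neq[symmetric])
  then show ?thesis by (rule continuous_on_eq) (simp add: Fvec_Mstar[OF _ True])
next
  case False
  then show ?thesis by (simp only: Fvec_def if_False continuous_on_const)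
qed

lemma diss_eq:
  assumes p: "p \<in> probvec q" and pos: "\<And>k. k \<in> {1..q} \<Longrightarrow> 0 < p k"
  shows "diss p = - (\<Sum>k\<in>{1..q}. Fvec \<beta> q p k * (ln (p k) - ln (Z k (Mstar p))))"
  unfolding diss_def using pos Z_pos
  by (intro arg_cong[of _ _ uminus] sum.cong refl) (simp add: ln_div less_imp_neq[symmetric])

text \<open>The logarithms of the coordinates confine the statement to the interior; this is why the
  compactness argument needs the uniform lower bound on the flow.\<close>

lemma continuous_on_diss:
  "continuous_on {p \<in> probvec q. \<forall>k\<in>{1..q}. 0 < p k} diss"
proof -
  let ?S = "{p \<in> probvec q. \<forall>k\<in>{1..q}. 0 < p k}"
  have ln_p: "continuous_on ?S (\<lambda>p. ln (p k))" if "k \<in> {1..q}" for k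
    using that by (intro continuous_on_ln coordinate_continuous) force
  have "continuous_on ?S (\<lambda>p. - (\<Sum>k\<in>{1..q}. Fvec \<beta> q p k * (ln (p k) - ln (Z k (Mstar p)))))"
    by (intro continuous_on_minus continuous_on_sum continuous_on_mult continuous_on_diff ln_p
        continuous_on_subset[OF continuous_on_Fvec] continuous_on_subset[OF continuous_on_ln_Z_Mstar]) auto
  then show ?thesis
  proof (rule continuous_on_eq)
    fix p assume "p \<in> ?S"
    then have "p \<in> probvec q" "\<And>k. k \<in> {1..q} \<Longrightarrow> 0 < p k" by auto
    from diss_eq[OF this]
    show "- (\<Sum>k\<in>{1..q}. Fvec \<beta> q p k * (ln (p k) - ln (Z k (Mstar p)))) = diss p" by (rule sym)
  qed
qed

end

section \<open>Decay of the free energy along a trajectory\<close>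

context rotor_flow
begin

lemma flow_vector_continuous: "continuous_on {0..} \<phi>"
  by (rule continuous_on_coordinatewise_then_product) (rule flow_continuous)

lemma flow_interior_deriv:
  assumes t: "0 < t"
  shows "((\<lambda>s. \<phi> s k) has_real_derivative Fvec \<beta> q (\<phi> t) k) (at t)"
proof -
  have "at t within {0..} = at t" using t by (intro at_within_interior) auto
  then show ?thesis using flow[of t k] t by simp
qed

text \<open>Envelope theorem: G is affine in p, so its minimum over M is squeezed between the
  values at the minimisers of neighbouring p.\<close>
lemma G_Mstar_deriv:
  assumes t: "0 < t"
  shows "((\<lambda>s. G (\<phi> s) (Mstar (\<phi> s))) has_real_derivative
    - (\<Sum>k\<in>{1..q}. Fvec \<beta> q (\<phi> t) k * ln (Z k (Mstar (\<phi> t))))) (at t)"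
proof -
  define L where "L s k = ln (Z k (Mstar (\<phi> s)))" for s k
  define W where "W s = G (\<phi> s) (Mstar (\<phi> s))" for s
  \<comment> \<open>\<open>e\<close> is the difference quotient of the part of \<open>W\<close>
    affine in the coordinates, up to sign, with the logarithms frozen at time \<open>t\<close>;
    \<open>r\<close> bounds the error of freezing them there instead of at time
    \<open>s\<close>.\<close>
  define e where "e s = (\<Sum>k\<in>{1..q}. (\<phi> s k - \<phi> t k) / (s - t) * L t k)" for s
  define r where "r s = (\<Sum>k\<in>{1..q}. \<bar>(\<phi> s k - \<phi> t k) / (s - t)\<bar> * \<bar>L s k - L t k\<bar>)" for s
  have quot: "((\<lambda>s. (\<phi> s k - \<phi> t k) / (s - t)) \<longlongrightarrow> Fvec \<beta> q (\<phi> t) k) (at t)" for k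
    using flow_interior_deriv[OF t, of k] by (simp add: has_field_derivative_iff)
  have "continuous_on {0..} (\<lambda>s. L s k)" for k
    unfolding L_def
    by (rule continuous_on_compose2[OF continuous_on_ln_Z_Mstar flow_vector_continuous]) (auto intro: flow_probvec)
  then have "isCont (\<lambda>s. L s k) t" for k
    using t by (intro continuous_on_interior) auto
  then have Lc: "((\<lambda>s. L s k) \<longlongrightarrow> L t k) (at t)" for k by (simp add: isCont_def)
  have "(r \<longlongrightarrow> (\<Sum>k\<in>{1..q}. \<bar>Fvec \<beta> q (\<phi> t) k\<bar> * \<bar>L t k - L t k\<bar>)) (at t)"
    unfolding r_def[abs_def] by (intro tendsto_intros quot Lc)
  then have r0: "(r \<longlongrightarrow> 0) (at t)" by simp
  have Gdiff: "G p M - G p' M = - (\<Sum>k\<in>{1..q}. (p k - p' k) * ln (Z k M))" for p p' M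
    by (simp add: G_def sum_subtractf left_diff_distrib)
  have bound: "norm ((W s - W t) / (s - t) + e s) \<le> r s" if s: "0 < s" "s \<noteq> t" for s
  proof -
    have ps: "\<phi> s \<in> probvec q" "\<phi> t \<in> probvec q" using s t by (auto intro: flow_probvec)
    define x where "x k = \<phi> s k - \<phi> t k" for k
    have up: "W s - W t \<le> - (\<Sum>k\<in>{1..q}. x k * L t k)"
      using G_Mstar_le(1)[OF ps(1), of "Mstar (\<phi> t)"] Gdiff[of "\<phi> s" "Mstar (\<phi> t)" "\<phi> t"]
      by (simp add: W_def L_def x_def)
    have down: "- (\<Sum>k\<in>{1..q}. x k * L s k) \<le> W s - W t"
      using G_Mstar_le(1)[OF ps(2), of "Mstar (\<phi> s)"] Gdiff[of "\<phi> s" "Mstar (\<phi> s)" "\<phi> t"]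
      by (simp add: W_def L_def x_def)
    have "\<bar>(W s - W t) + (\<Sum>k\<in>{1..q}. x k * L t k)\<bar> \<le> \<bar>\<Sum>k\<in>{1..q}. x k * (L s k - L t k)\<bar>"
      using up down by (simp add: right_diff_distrib sum_subtractf)
    also have "\<dots> \<le> (\<Sum>k\<in>{1..q}. \<bar>x k\<bar> * \<bar>L s k - L t k\<bar>)"
      by (rule order_trans[OF sum_abs]) (simp add: abs_mult)
    finally have "\<bar>(W s - W t) + (\<Sum>k\<in>{1..q}. x k * L t k)\<bar> / \<bar>s - t\<bar> \<le> (\<Sum>k\<in>{1..q}. \<bar>x k\<bar> * \<bar>L s k - L t k\<bar>) / \<bar>s - t\<bar>"
      by (rule divide_right_mono) simp
    moreover have "(W s - W t) / (s - t) + e s = ((W s - W t) + (\<Sum>k\<in>{1..q}. x k * L t k)) / (s - t)"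
      by (simp add: e_def x_def add_divide_distrib sum_divide_distrib)
    moreover have "r s = (\<Sum>k\<in>{1..q}. \<bar>x k\<bar> * \<bar>L s k - L t k\<bar>) / \<bar>s - t\<bar>"
      by (simp add: r_def x_def sum_divide_distrib)
    ultimately show ?thesis by simp
  qed
  have "eventually (\<lambda>s. s \<in> {0<..} - {t}) (at t)"
    using t by (intro eventually_at_in_open) auto
  then have "eventually (\<lambda>s. norm ((W s - W t) / (s - t) + e s) \<le> r s) (at t)"
    by eventually_elim (use bound in auto)
  then have "((\<lambda>s. (W s - W t) / (s - t) + e s) \<longlongrightarrow> 0) (at t)"
    using r0 by (rule Lim_null_comparison)
  moreover have "(e \<longlongrightarrow> (\<Sum>k\<in>{1..q}. Fvec \<beta> q (\<phi> t) k * L t k)) (at t)"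
    unfolding e_def[abs_def] by (intro tendsto_intros quot)
  ultimately have "((\<lambda>s. (W s - W t) / (s - t) + e s - e s) \<longlongrightarrow> 0 - (\<Sum>k\<in>{1..q}. Fvec \<beta> q (\<phi> t) k * L t k)) (at t)"
    by (rule tendsto_diff)
  then have "(W has_real_derivative - (\<Sum>k\<in>{1..q}. Fvec \<beta> q (\<phi> t) k * L t k)) (at t)"
    by (simp add: has_field_derivative_iff)
  then show ?thesis by (simp add: W_def[abs_def] L_def)
qed

lemma V_deriv:
  assumes t: "0 < t"
  shows "((\<lambda>s. V (\<phi> s)) has_real_derivative - diss (\<phi> t)) (at t)"
proof -
  have pt: "\<phi> t \<in> probvec q" using t by (intro flow_probvec) simp
  have d: "diss (\<phi> t) = - (\<Sum>k\<in>{1..q}. Fvec \<beta> q (\<phi> t) k * (ln (\<phi> t k) - ln (Z k (Mstar (\<phi> t)))))"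
    by (rule diss_eq[OF pt]) (rule flow_pos[OF t])
  have x: "(xlogx has_real_derivative ln y + 1) (at y)" if "0 < y" for y
  proof -
    have "((\<lambda>y. y * ln y) has_real_derivative ln y + 1) (at y)"
      using that by (auto intro!: derivative_eq_intros)
    then show ?thesis
      by (rule has_field_derivative_transform_within_open[of _ _ _ "{0<..}"]) (use that in \<open>auto simp: xlogx_def\<close>)
  qed
  have "((\<lambda>s. H (\<phi> s)) has_real_derivative (\<Sum>k\<in>{1..q}. (ln (\<phi> t k) + 1) * Fvec \<beta> q (\<phi> t) k)) (at t)"
    unfolding H_def by (intro DERIV_sum DERIV_chain2[OF x] flow_interior_deriv flow_pos t)
  from DERIV_add[OF this G_Mstar_deriv[OF t]]
  have "((\<lambda>s. V (\<phi> s)) has_real_derivative (\<Sum>k\<in>{1..q}. (ln (\<phi> t k) + 1) * Fvec \<beta> q (\<phi> t) k)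
     + - (\<Sum>k\<in>{1..q}. Fvec \<beta> q (\<phi> t) k * ln (Z k (Mstar (\<phi> t))))) (at t)"
    by (simp add: V_def)
  moreover have "(\<Sum>k\<in>{1..q}. (ln (\<phi> t k) + 1) * Fvec \<beta> q (\<phi> t) k)
     + - (\<Sum>k\<in>{1..q}. Fvec \<beta> q (\<phi> t) k * ln (Z k (Mstar (\<phi> t))))
     = - diss (\<phi> t) + (\<Sum>k\<in>{1..q}. Fvec \<beta> q (\<phi> t) k)"
    unfolding d by (simp add: algebra_simps sum.distrib sum_subtractf)
  ultimately show ?thesis using sum_Fvec[of q \<beta> "\<phi> t"] q_ge_2 by simp
qed

lemma V_flow_continuous: "continuous_on {0..} (\<lambda>s. V (\<phi> s))"
  by (rule continuous_on_compose2[OF continuous_on_V flow_vector_continuous]) (auto intro: flow_probvec)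

text \<open>Used with \<open>m = 0\<close> for monotonicity and with a positive \<open>m\<close> for
  a linear rate of decay. The bound is required only after time \<open>s\<close>, so
  \<open>s\<close> may be 0.\<close>

lemma V_decreases:
  assumes st: "0 \<le> s" "s \<le> t" and m: "\<And>x. s < x \<Longrightarrow> m \<le> diss (\<phi> x)"
  shows "V (\<phi> t) + m * t \<le> V (\<phi> s) + m * s"
proof (rule nonincreasing_of_deriv_nonpos[OF st, where f="\<lambda>s. V (\<phi> s) + m * s" and f'="\<lambda>t. - diss (\<phi> t) + m * 1"])
  show "continuous_on {0..} (\<lambda>s. V (\<phi> s) + m * s)"
    by (intro continuous_intros V_flow_continuous)
  fix x assume x: "s < x"
  show "((\<lambda>s. V (\<phi> s) + m * s) has_real_derivative - diss (\<phi> x) + m * 1) (at x within {0..})"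
    using x st by (intro DERIV_add DERIV_cmult DERIV_ident has_field_derivative_at_within[OF V_deriv]) auto
  show "- diss (\<phi> x) + m * 1 \<le> 0" using m[OF x] by simp
qed

lemma V_flow_le:
  assumes t: "0 \<le> t"
  shows "V (\<phi> t) \<le> V (\<phi> 0)"
  using V_decreases[of 0 t 0] t diss_nonneg(1)[OF flow_probvec flow_pos] by simp

lemma flow_enters:
  assumes V0: "V (\<phi> 0) < V (uniform q)" and T: "open T"
    and min: "\<And>p. p \<in> probvec q \<Longrightarrow> (\<And>p'. p' \<in> probvec q \<Longrightarrow> V p \<le> V p') \<Longrightarrow> p \<in> T"
  shows "\<exists>t\<ge>0. \<phi> t \<in> T"
proof (rule ccontr)
  assume "\<not> (\<exists>t\<ge>0. \<phi> t \<in> T)"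
  then have notT: "\<phi> t \<notin> T" if "0 \<le> t" for t using that by blast
  obtain \<delta> where \<delta>: "0 < \<delta>" "\<And>t j. real q * 1 \<le> t \<Longrightarrow> j \<in> {1..q} \<Longrightarrow> \<delta> \<le> \<phi> t j"
    using flow_uniformly_positive[OF zero_less_one] by metis
  \<comment> \<open>The level set excludes the uniform vector, the bound \<delta> keeps
    \<open>diss\<close> continuous, and the complement of \<open>T\<close> excludes the minimisers:
    no critical point is left in \<open>K\<close>.\<close>
  define K where "K = {p \<in> probvec q. V p \<le> V (\<phi> 0)} \<inter> (\<Inter>k\<in>{1..q}. {p. \<delta> \<le> p k}) \<inter> - T"
  have K: "\<phi> t \<in> K" if "real q \<le> t" for t
    using that flow_probvec[of t] V_flow_le[of t] \<delta>(2)[of t] notT[of t] by (auto simp: K_def)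
  have "compact K"
  proof -
    have "closed {p \<in> probvec q. V p \<le> V (\<phi> 0)}"
      using continuous_on_closed_Collect_le[OF continuous_on_V continuous_on_const]
      by (simp add: compact_imp_closed[OF compact_probvec])
    then have "closed K" unfolding K_def using T by (intro closed_Int closed_INT ballI closed_coordinate closed_Compl) auto
    moreover have "K = probvec q \<inter> K" by (auto simp: K_def)
    ultimately show ?thesis using compact_Int_closed[OF compact_probvec] by metis
  qed
  moreover have "K \<noteq> {}" using K by blast
  moreover have Kpos: "K \<subseteq> {p \<in> probvec q. \<forall>k\<in>{1..q}. 0 < p k}"
    using \<delta>(1) by (fastforce simp: K_def intro: less_le_trans)
  then have "continuous_on K diss" by (rule continuous_on_subset[OF continuous_on_diss])
  ultimately obtain p0 where p0: "p0 \<in> K" "\<And>p. p \<in> K \<Longrightarrow> diss p0 \<le> diss p"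
    using continuous_attains_inf[of K diss] by blast
  define m where "m = diss p0"
  have p0': "p0 \<in> probvec q" "\<And>k. k \<in> {1..q} \<Longrightarrow> 0 < p0 k" using p0(1) Kpos by auto
  have "m \<noteq> 0"
  proof
    assume "m = 0"
    then consider "p0 = uniform q" | "\<forall>p'\<in>probvec q. V p0 \<le> V p'"
      using critical_point[OF p0'] by (auto simp: m_def)
    then show False using p0(1) V0 min[OF p0'(1)] by cases (auto simp: K_def)
  qed
  then have m: "0 < m" using diss_nonneg(1)[OF p0'] by (simp add: m_def)
  obtain b where b: "\<And>p. p \<in> probvec q \<Longrightarrow> b \<le> V p" using V_bounded_below by blast
  \<comment> \<open>By this time a decrease at rate \<open>m\<close>, starting at time
    \<open>q\<close>, would have taken \<open>V\<close> below its lower bound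
    \<open>b\<close>.\<close>
  define t where "t = real q + (\<bar>V (\<phi> q) - b\<bar> + 1) / m"
  have tq: "real q \<le> t" using m by (simp add: t_def)
  have "V (\<phi> t) + m * t \<le> V (\<phi> q) + m * q"
    by (rule V_decreases) (use tq p0(2) K in \<open>auto simp: m_def\<close>)
  moreover have "m * t = m * q + (\<bar>V (\<phi> q) - b\<bar> + 1)" using m by (simp add: t_def field_simps)
  moreover have "b \<le> V (\<phi> t)" using tq by (intro b flow_probvec) simp
  ultimately show False by linarith
qed

end

theorem theorem1p8:
  fixes \<beta> :: real and q :: nat and p :: "nat \<Rightarrow> real"
    and U :: "(nat \<Rightarrow> real) set" and \<phi> :: "real \<Rightarrow> nat \<Rightarrow> real"
  assumes "\<beta> > 2" and "q \<ge> 1" and "\<beta> * (sin (pi / real q))\<^sup>2 < 1"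
    and "p \<in> probvec q"
    and "Psi' \<beta> q p < Psi' \<beta> q (uniform q)"
    and "openin (top_of_set (probvec q)) U" and "G' \<beta> q \<subseteq> U"
    and "\<phi> 0 = p"
    and "\<And>t k. t \<ge> 0 \<Longrightarrow>
           ((\<lambda>s. \<phi> s k) has_real_derivative Fvec \<beta> q (\<phi> t) k) (at t within {0..})"
  shows "\<exists>t\<ge>0. \<phi> t \<in> U"
proof -
  \<comment> \<open>For q = 1 the smallness condition holds trivially, as sin(pi) = 0, but the only
    probability vector is uniform and the strict inequality fails.\<close>
  have "q \<noteq> 1"
  proof
    assume q: "q = 1"
    have "p k = uniform q k" for k
      using assms(4) unfolding probvec_def uniform_def q by auto
    then have "p = uniform q" by auto
    then show False using assms(5) by simp
  qed
  then interpret rotor_flow \<beta> q \<phi>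
    using assms by unfold_locales auto
  obtain c where c: "\<And>p. p \<in> probvec q \<Longrightarrow> Psi' \<beta> q p = ereal (V p - c)"
    using Psi'_eq by blast
  obtain T where T: "open T" "U = probvec q \<inter> T"
    using assms(6) by (auto simp: openin_open)
  have "\<exists>t\<ge>0. \<phi> t \<in> T"
  proof (rule flow_enters[OF _ T(1)])
    show "V (\<phi> 0) < V (uniform q)"
      using assms(4,5,8) by (simp add: c uniform_probvec)
    fix p' assume "p' \<in> probvec q" "\<And>p''. p'' \<in> probvec q \<Longrightarrow> V p' \<le> V p''"
    then have "p' \<in> G' \<beta> q" by (simp add: G'_def c)
    then show "p' \<in> T" using assms(7) T(2) by blast
  qed
  then show ?thesis using T(2) flow_probvec by blast
qed

end
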